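(* Let $p,q\ge 3$ and $l\ge 1$, and let $G_w$ be a weighted bicyclic graph of order $n$ having at least one pendant vertex, whose base is $\infty(p,l,q)$. Then $$i_+(G_w)\ge \begin{cases}\frac{p+q}{2}, & \text{if } p,q \text{ are both odd};\\ \frac{p+q}{2}-1, & \text{if } p,q \text{ are both even};\\ \frac{p+q-1}{2}, & \text{otherwise.}\end{cases}$$ Moreover, this bound is sharp.
   Context: A weighted graph $G_w$ is a simple graph $G$ with a positive weight on each edge; its adjacency matrix has entry $w(v_iv_j)$ if $v_iv_j\in E(G)$ and $0$ otherwise, and $i_+(G_w)$ (resp. $i_-(G_w)$, $i_0(G_w)$) is the number of positive (resp. negative, zero) eigenvalues of this matrix, with multiplicity. A bicyclic graph is a connected simple graph with $|E|=|V|+1$. The base of a bicyclic graph $G$ is its unique bicyclic subgraph containing no pendant vertices (so $G$ is obtained from its base by attaching trees). For $p,q\ge 3$ and $l\ge1$, $\infty(p,l,q)$ is the graph obtained from two vertex-disjoint cycles $C^p$, $C^q$ (of lengths $p,q$) and a path $P_l=v_1v_2\cdots v_l$ on $l$ vertices by identifying $v_1$ with a vertex $v$ of $C^p$ and $v_l$ with a vertex $u$ of $C^q$ (when $l=1$ the two cycles share exactly one vertex). *)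

theory Defs
  imports
    "Graph_Theory.Pair_Digraph"
    "Graph_Theory.Digraph_Component"
    "Graph_Theory.Digraph_Isomorphism"
    "Jordan_Normal_Form.Char_Poly"
begin

text \<open>
  A finite simple graph is a \<open>pair_graph\<close> of the session Graph_Theory: a finite, loop-free,
  symmetric digraph without parallel arcs.  An edge \<open>uv\<close> is thus a pair of opposite arcs, and the
  degree of a vertex is its out-degree.
\<close>

definition uedges :: "'a pair_pre_digraph \<Rightarrow> 'a set set" where
  "uedges G = (\<lambda>(u, v). {u, v}) ` parcs G"

definition weighted_graph :: "'a pair_pre_digraph \<Rightarrow> ('a set \<Rightarrow> real) \<Rightarrow> bool" where
  "weighted_graph G w \<longleftrightarrow> pair_graph G \<and> (\<forall>e \<in> uedges G. 0 < w e)"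

text \<open>The vertices are listed as \<open>v 0, \<dots>, v (n - 1)\<close>.\<close>

definition adjacency_matrix ::
  "nat \<Rightarrow> (nat \<Rightarrow> 'a) \<Rightarrow> 'a pair_pre_digraph \<Rightarrow> ('a set \<Rightarrow> real) \<Rightarrow> real mat" where
  "adjacency_matrix n v G w =
     mat n n (\<lambda>(i, j). if (v i, v j) \<in> parcs G then w {v i, v j} else 0)"

text \<open>
  Multiplicities are algebraic.  For symmetric matrices, the only ones used here, all complex
  eigenvalues are real and algebraic and geometric multiplicities agree.
\<close>

definition positive_inertia :: "real mat \<Rightarrow> nat" where
  "positive_inertia A = (\<Sum>x | eigenvalue A x \<and> 0 < x. order x (char_poly A))"

definition bicyclic :: "'a pair_pre_digraph \<Rightarrow> bool" where
  "bicyclic G \<longleftrightarrow>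
     pair_graph G \<and> Digraph_Component.connected (with_proj G) \<and>
     card (uedges G) = card (pverts G) + 1"

definition pendant_vertex :: "'a pair_pre_digraph \<Rightarrow> 'a \<Rightarrow> bool" where
  "pendant_vertex G x \<longleftrightarrow> x \<in> pverts G \<and> out_degree (with_proj G) x = 1"

text \<open>A relation rather than a function; a bicyclic graph has exactly one base.\<close>

definition base_of :: "'a pair_pre_digraph \<Rightarrow> 'a pair_pre_digraph \<Rightarrow> bool" where
  "base_of H G \<longleftrightarrow>
     subgraph (with_proj H) (with_proj G) \<and> bicyclic H \<and> (\<nexists>x. pendant_vertex H x)"

text \<open>
  The graph \<open>\<infinity>(p, l, q)\<close>: the disjoint union of the cycles \<open>CP 0, \<dots>, CP (p - 1)\<close> and
  \<open>CQ 0, \<dots>, CQ (q - 1)\<close> and the path \<open>PL 1, \<dots>, PL l\<close>, in which \<open>CP 0\<close> is identified with \<open>PL 1\<close>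
  and \<open>CQ 0\<close> with \<open>PL l\<close>.
\<close>

datatype infty_vertex = CP nat | PL nat | CQ nat

definition cycle_arcs :: "nat \<Rightarrow> nat rel" where
  "cycle_arcs m = {(i, j). i < m \<and> j < m \<and> (j = (i + 1) mod m \<or> i = (j + 1) mod m)}"

definition path_arcs :: "nat \<Rightarrow> nat rel" where
  "path_arcs l = {(i, j). i \<in> {1..l} \<and> j \<in> {1..l} \<and> (j = i + 1 \<or> i = j + 1)}"

fun glue :: "nat \<Rightarrow> infty_vertex \<Rightarrow> infty_vertex" where
  "glue l (CP i) = (if i = 0 then PL 1 else CP i)"
| "glue l (PL i) = PL i"
| "glue l (CQ i) = (if i = 0 then PL l else CQ i)"

definition infty_graph :: "nat \<Rightarrow> nat \<Rightarrow> nat \<Rightarrow> infty_vertex pair_pre_digraph" where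
  "infty_graph p l q =
     \<lparr> pverts = glue l ` (CP ` {..<p} \<union> PL ` {1..l} \<union> CQ ` {..<q}),
       parcs = map_prod (glue l) (glue l) `
         (map_prod CP CP ` cycle_arcs p \<union> map_prod PL PL ` path_arcs l \<union>
          map_prod CQ CQ ` cycle_arcs q) \<rparr>"

definition has_infty_base :: "nat \<Rightarrow> nat \<Rightarrow> nat \<Rightarrow> 'a pair_pre_digraph \<Rightarrow> bool" where
  "has_infty_base p l q G \<longleftrightarrow>
     (\<exists>H. base_of H G \<and> digraph_iso (with_proj H) (with_proj (infty_graph p l q)))"

definition inertia_bound :: "nat \<Rightarrow> nat \<Rightarrow> real" where
  "inertia_bound p q =
     (if odd p \<and> odd q then (real p + real q) / 2
      else if even p \<and> even q then (real p + real q) / 2 - 1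
      else (real p + real q - 1) / 2)"

end

theory Submission
  imports Defs "HOL-Computational_Algebra.Fundamental_Theorem_Algebra"
begin

text \<open>
  In all parity cases the bound equals \<open>1 + (p - 1) div 2 + (q - 1) div 2\<close>.  By diagonalisation, if the
  adjacency matrix restricts to zero on a set \<open>X\<close> of vertices, then \<open>i\<^sub>+ \<le> n - |X|\<close>; and if moreover it is
  injective on the vectors supported on \<open>X\<close>, then \<open>|X| \<le> i\<^sub>+\<close>.  Injectivity holds as soon as the vertices of
  \<open>X\<close> can be matched to neighbours in such a way that the block of the matrix between the two sides is triangular.

  For the lower bound, counting edges shows that the base is an induced subgraph and that some vertex \<open>y\<close>
  outside has exactly one neighbour \<open>x\<close> in it.  Match \<open>y\<close> to \<open>x\<close>.  Delete one vertex from each cycle, namely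
  \<open>x\<close> if it lies on the cycle and the attaching vertex otherwise, and match every second vertex of the remaining
  path to its neighbour; direction and starting point can be chosen so that the attaching vertex is at most
  a right-hand side, which keeps the left-hand sides of the two cycles non-adjacent.

  Equality holds for \<open>l = 1\<close> with one pendant vertex at the common vertex of the cycles: the pendant vertex and
  alternate cycle vertices form an independent set of the required size.
\<close>

section \<open>Inertia of real symmetric matrices\<close>

text \<open>Elimination, by induction on the equations. An equation with a nonzero coefficient at
  \<open>k\<close> is solved for that unknown and substituted into the others, which leaves one
  equation and one unknown fewer; an equation without nonzero coefficients on \<open>J\<close> is
  dropped.\<close>

lemma underdetermined_system_solution:
  fixes M :: "'i \<Rightarrow> 'j \<Rightarrow> 'a::field"
  assumes "finite I" "finite J" "card I < card J"
  shows "\<exists>a. (\<exists>j\<in>J. a j \<noteq> 0) \<and> (\<forall>j. j \<notin> J \<longrightarrow> a j = 0) \<and> (\<forall>i\<in>I. (\<Sum>j\<in>J. M i j * a j) = 0)"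
  using assms
proof (induction I arbitrary: J M rule: finite_induct)
  case empty
  then obtain j0 where "j0 \<in> J" by fastforce
  then show ?case by (intro exI[of _ "\<lambda>j. if j = j0 then 1 else 0"]) auto
next
  case (insert i I)
  show ?case
  proof (cases "\<forall>j\<in>J. M i j = 0")
    case True
    with insert.IH[of J M] insert.prems insert.hyps show ?thesis by auto
  next
    case False
    then obtain k where k: "k \<in> J" "M i k \<noteq> 0" by blast
    define J' where "J' = J - {k}"
    have J': "finite J'" "card I < card J'" "k \<notin> J'" "J = insert k J'"
      using insert.prems insert.hyps k by (auto simp: J'_def)
    from insert.IH[OF J'(1,2), of "\<lambda>h j. M h j - M h k * M i j / M i k"]
    obtain a where a: "\<exists>j\<in>J'. a j \<noteq> 0" "\<forall>j. j \<notin> J' \<longrightarrow> a j = 0"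
      "\<forall>h\<in>I. (\<Sum>j\<in>J'. (M h j - M h k * M i j / M i k) * a j) = 0" by blast
    define b where "b = a(k := - (\<Sum>j\<in>J'. M i j * a j) / M i k)"
    have sum_b: "(\<Sum>j\<in>J. M h j * b j) = M h k * b k + (\<Sum>j\<in>J'. M h j * a j)" for h
    proof -
      have "(\<Sum>j\<in>J'. M h j * b j) = (\<Sum>j\<in>J'. M h j * a j)"
        using J'(3) by (intro sum.cong) (auto simp: b_def)
      then show ?thesis using J' by simp
    qed
    have "(\<Sum>j\<in>J. M h j * b j) = 0" if "h \<in> insert i I" for h
    proof (cases "h = i")
      case True
      then show ?thesis unfolding sum_b using k by (simp add: b_def)
    next
      case False
      then have "(\<Sum>j\<in>J'. (M h j - M h k * M i j / M i k) * a j) = 0" using that a by auto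
      moreover have "(\<Sum>j\<in>J'. (M h j - M h k * M i j / M i k) * a j)
          = (\<Sum>j\<in>J'. M h j * a j) - M h k / M i k * (\<Sum>j\<in>J'. M i j * a j)"
        by (simp add: sum_subtractf sum_distrib_left algebra_simps)
      ultimately show ?thesis unfolding sum_b by (simp add: b_def)
    qed
    moreover have "\<exists>j\<in>J. b j \<noteq> 0" using a(1) J' by (auto simp: b_def)
    moreover have "\<forall>j. j \<notin> J \<longrightarrow> b j = 0" using a(2) J' by (auto simp: b_def)
    ultimately show ?thesis by blast
  qed
qed

section \<open>The spectral theorem for real symmetric matrices\<close>

lemma complex_eigenvector_exists:
  fixes A :: "complex mat"
  assumes "A \<in> carrier_mat n n" "0 < n"
  shows "\<exists>z c. z \<in> carrier_vec n \<and> z \<noteq> 0\<^sub>v n \<and> A *\<^sub>v z = c \<cdot>\<^sub>v z"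
proof -
  have "degree (char_poly A) = n" using degree_monic_char_poly[OF assms(1)] by simp
  then have "\<not> constant (poly (char_poly A))" using assms(2) by (simp add: constant_degree)
  then obtain c where "poly (char_poly A) c = 0" using fundamental_theorem_of_algebra by blast
  then have "eigenvalue A c" using eigenvalue_root_char_poly[OF assms(1)] by simp
  then show ?thesis using assms unfolding eigenvalue_def eigenvector_def by auto
qed

lemma symmetric_mat_scalar_prod:
  fixes A :: "'a::comm_ring_1 mat"
  assumes "A \<in> carrier_mat n n" "transpose_mat A = A" "x \<in> carrier_vec n" "y \<in> carrier_vec n"
  shows "x \<bullet> (A *\<^sub>v y) = y \<bullet> (A *\<^sub>v x)"
  using assms by (metis transpose_vec_mult_scalar comm_scalar_prod mult_mat_vec_carrier)

text \<open>Split a complex eigenvector into \<open>x\<close> and \<open>y\<close>, its real and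
  imaginary parts. Symmetry equates \<open>y \<bullet> (A *\<^sub>v x)\<close> with
  \<open>x \<bullet> (A *\<^sub>v y)\<close>, and comparing the two expansions kills
  \<open>Im c\<close>. Then \<open>x\<close> and \<open>y\<close> both satisfy the real eigenvalue
  equation, and whichever is nonzero can be normalised.\<close>

lemma real_symmetric_eigenvector_exists:
  fixes A :: "real mat"
  assumes A: "A \<in> carrier_mat n n" and sym: "transpose_mat A = A" and n: "0 < n"
  shows "\<exists>u l. u \<in> carrier_vec n \<and> u \<bullet> u = 1 \<and> A *\<^sub>v u = l \<cdot>\<^sub>v u"
proof -
  obtain z c where z: "z \<in> carrier_vec n" "z \<noteq> 0\<^sub>v n"
    and ev: "map_mat complex_of_real A *\<^sub>v z = c \<cdot>\<^sub>v z"
    using complex_eigenvector_exists[of "map_mat complex_of_real A" n] A n by auto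
  define x where "x = map_vec Re z"
  define y where "y = map_vec Im z"
  have xy: "x \<in> carrier_vec n" "y \<in> carrier_vec n" using z by (auto simp: x_def y_def)
  have comp: "(\<Sum>j = 0..<n. complex_of_real (A $$ (i, j)) * z $ j) = c * z $ i" if "i < n" for i
  proof -
    have "(map_mat of_real A *\<^sub>v z) $ i = (c \<cdot>\<^sub>v z) $ i" using ev by simp
    then show ?thesis using that A z by (simp add: scalar_prod_def)
  qed
  have Ax: "A *\<^sub>v x = Re c \<cdot>\<^sub>v x - Im c \<cdot>\<^sub>v y"
  proof (rule eq_vecI)
    fix i assume "i < dim_vec (Re c \<cdot>\<^sub>v x - Im c \<cdot>\<^sub>v y)"
    then have "i < n" using xy by simp
    from arg_cong[OF comp[OF this], of Re] show "(A *\<^sub>v x) $ i = (Re c \<cdot>\<^sub>v x - Im c \<cdot>\<^sub>v y) $ i"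
      using \<open>i < n\<close> A z by (simp add: scalar_prod_def x_def y_def)
  qed (use A xy in auto)
  have Ay: "A *\<^sub>v y = Re c \<cdot>\<^sub>v y + Im c \<cdot>\<^sub>v x"
  proof (rule eq_vecI)
    fix i assume "i < dim_vec (Re c \<cdot>\<^sub>v y + Im c \<cdot>\<^sub>v x)"
    then have "i < n" using xy by simp
    from arg_cong[OF comp[OF this], of Im] show "(A *\<^sub>v y) $ i = (Re c \<cdot>\<^sub>v y + Im c \<cdot>\<^sub>v x) $ i"
      using \<open>i < n\<close> A z by (simp add: scalar_prod_def x_def y_def)
  qed (use A xy in auto)
  have "y \<bullet> (A *\<^sub>v x) = Re c * (y \<bullet> x) - Im c * (y \<bullet> y)"
    unfolding Ax using xy by (simp add: scalar_prod_minus_distrib[of _ n])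
  moreover have "x \<bullet> (A *\<^sub>v y) = Re c * (x \<bullet> y) + Im c * (x \<bullet> x)"
    unfolding Ay using xy by (simp add: scalar_prod_add_distrib[of _ n])
  ultimately have "Im c * (x \<bullet> x + y \<bullet> y) = 0"
    using symmetric_mat_scalar_prod[OF A sym xy] comm_scalar_prod[OF xy] by (simp add: algebra_simps)
  moreover have nonneg: "v \<bullet> v \<ge> 0" for v :: "real vec"
    unfolding scalar_prod_def by (intro sum_nonneg) simp
  have pos: "v \<bullet> v > 0" if "v \<in> carrier_vec n" "v \<noteq> 0\<^sub>v n" for v :: "real vec"
  proof -
    have "\<exists>i<n. v $ i \<noteq> 0"
    proof (rule ccontr)
      assume "\<not> ?thesis"
      then have "v = 0\<^sub>v n" using that(1) by (intro eq_vecI) auto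
      with that show False by simp
    qed
    then obtain i where "i < n" "v $ i \<noteq> 0" by blast
    then have "0 < v $ i * v $ i" using not_real_square_gt_zero by blast
    also have "\<dots> \<le> v \<bullet> v" unfolding scalar_prod_def using \<open>i < n\<close> that
      by (intro member_le_sum) auto
    finally show ?thesis .
  qed
  have ne: "x \<noteq> 0\<^sub>v n \<or> y \<noteq> 0\<^sub>v n"
  proof (rule ccontr)
    assume zero: "\<not> ?thesis"
    then have "Re (z $ i) = 0 \<and> Im (z $ i) = 0" if "i < n" for i
    proof -
      have "x $ i = 0" "y $ i = 0" using zero that by auto
      then show ?thesis using that z by (simp add: x_def y_def)
    qed
    then have "z = 0\<^sub>v n" using z by (intro eq_vecI) (auto simp: complex_eq_iff)
    with z show False by simp
  qed
  then have "x \<bullet> x + y \<bullet> y > 0" using pos nonneg xy by (metis add_nonneg_pos add_pos_nonneg)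
  ultimately have "Im c = 0" by simp
  then have "A *\<^sub>v x = Re c \<cdot>\<^sub>v x" "A *\<^sub>v y = Re c \<cdot>\<^sub>v y" using Ax Ay xy by auto
  with ne xy obtain v where v: "v \<in> carrier_vec n" "v \<noteq> 0\<^sub>v n" "A *\<^sub>v v = Re c \<cdot>\<^sub>v v" by blast
  define u where "u = (1 / sqrt (v \<bullet> v)) \<cdot>\<^sub>v v"
  have "u \<bullet> u = 1" using pos[OF v(1,2)] v(1) by (simp add: u_def)
  moreover have "A *\<^sub>v u = Re c \<cdot>\<^sub>v u"
    unfolding u_def using v A by (simp add: mult_mat_vec smult_smult_assoc mult.commute)
  moreover have "u \<in> carrier_vec n" using v by (simp add: u_def)
  ultimately show ?thesis by blast
qed

text \<open>This is the Householder reflection along \<open>w\<close>, the difference of the first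
  unit vector and \<open>u\<close>. Since \<open>u\<close> has norm 1, the squared norm of
  \<open>w\<close> is \<open>2 * w 0\<close>, so the usual factor 2 over the squared norm becomes
  \<open>inverse (w 0)\<close>.\<close>

lemma orthogonal_reflection_exists:
  fixes u :: "real vec"
  assumes u: "u \<in> carrier_vec n" and uu: "u \<bullet> u = 1" and n: "0 < n"
  shows "\<exists>H. H \<in> carrier_mat n n \<and> transpose_mat H = H \<and> H * H = 1\<^sub>m n \<and> col H 0 = u"
proof -
  define w where "w = (\<lambda>i. (if i = 0 then 1 else 0) - u $ i)"
  \<comment> \<open>If \<open>u\<close> is itself the first unit vector, then \<open>w\<close>
    vanishes, \<open>inverse 0 = 0\<close>, and \<open>H\<close> is the identity, as it should
    be.\<close>
  define c where "c = inverse (w 0)"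
  define H where "H = mat n n (\<lambda>(i, j). (if i = j then 1 else 0) - c * w i * w j)"
  have sq: "(\<Sum>k = 0..<n. u $ k * u $ k) = 1"
    using uu u by (simp add: scalar_prod_def)
  have "w k * w k = (if k = 0 then 1 - 2 * u $ k else 0) + u $ k * u $ k" for k
    by (simp add: w_def algebra_simps)
  then have W: "(\<Sum>k = 0..<n. w k * w k) = 2 * w 0"
    using n by (simp add: sum.distrib sq w_def)
  have w0: "w i = 0" if "w 0 = 0" "i < n" for i
  proof -
    have "(\<Sum>k = 0..<n. w k * w k) = 0" using W that by simp
    then have "w i * w i = 0" using that by (subst (asm) sum_nonneg_eq_0_iff) auto
    then show ?thesis by simp
  qed
  have "H * H = 1\<^sub>m n"
  proof (rule eq_matI)
    fix i j assume "i < dim_row (1\<^sub>m n :: real mat)" "j < dim_col (1\<^sub>m n :: real mat)"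
    then have ij: "i < n" "j < n" by auto
    have "(H * H) $$ (i, j) = (\<Sum>k = 0..<n.
        ((if i = k then 1 else 0) - c * w i * w k) * ((if k = j then 1 else 0) - c * w k * w j))"
      using ij by (simp add: H_def scalar_prod_def)
    also have "\<dots> = (\<Sum>k = 0..<n. (if i = k then (if k = j then 1 else 0) - c * w k * w j else 0)
        - (if k = j then c * w i * w k else 0) + c * c * w i * w j * (w k * w k))"
      by (intro sum.cong) (auto simp: algebra_simps)
    also have "\<dots> = (if i = j then 1 else 0) - 2 * (c * w i * w j) + c * c * w i * w j * (2 * w 0)"
      unfolding W[symmetric] using ij by (simp add: sum.distrib sum_subtractf sum_distrib_left)
    also have "\<dots> = (if i = j then 1 else 0)"
      by (cases "w 0 = 0") (simp_all add: c_def field_simps)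
    finally show "(H * H) $$ (i, j) = 1\<^sub>m n $$ (i, j)" using ij by simp
  qed (auto simp: H_def)
  moreover have "col H 0 = u"
  proof (rule eq_vecI)
    fix i assume "i < dim_vec u"
    then have "i < n" using u by simp
    then have "w i = c * w i * w 0" using w0[of i] by (cases "w 0 = 0") (auto simp: c_def)
    then show "col H 0 $ i = u $ i" using \<open>i < n\<close> n by (auto simp: H_def) (auto simp: w_def)
  qed (use u n in \<open>auto simp: H_def\<close>)
  moreover have "transpose_mat H = H" by (rule eq_matI) (auto simp: H_def)
  moreover have "H \<in> carrier_mat n n" by (simp add: H_def)
  ultimately show ?thesis by blast
qed

lemma mult_mat_unit_vec:
  fixes A :: "'a::semiring_1 mat"
  assumes "A \<in> carrier_mat m n" "j < n"
  shows "A *\<^sub>v unit_vec n j = col A j"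
  using assms by (intro eq_vecI) auto

text \<open>Deflation: conjugating by a reflection whose first column is a unit eigenvector clears
  the first column outside the diagonal, and by symmetry also the first row. The remaining block
  \<open>C\<close> is diagonalised by the induction hypothesis, and \<open>H\<close> times the
  bordered \<open>Q\<close> diagonalises \<open>A\<close>.\<close>

lemma real_symmetric_spectral:
  fixes A :: "real mat"
  assumes "A \<in> carrier_mat n n" "transpose_mat A = A"
  shows "\<exists>Q d. Q \<in> carrier_mat n n \<and> Q * transpose_mat Q = 1\<^sub>m n \<and> transpose_mat Q * Q = 1\<^sub>m n
    \<and> A = Q * mat_diag n d * transpose_mat Q"
  using assms
proof (induction n arbitrary: A)
  case 0
  then show ?case by (intro exI[of _ "1\<^sub>m 0"]) (auto intro!: eq_matI)
next
  case (Suc m)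
  obtain u l where u: "u \<in> carrier_vec (Suc m)" "u \<bullet> u = 1" "A *\<^sub>v u = l \<cdot>\<^sub>v u"
    using real_symmetric_eigenvector_exists[OF Suc.prems] by auto
  obtain H where H: "H \<in> carrier_mat (Suc m) (Suc m)" "transpose_mat H = H"
    "H * H = 1\<^sub>m (Suc m)" "col H 0 = u"
    using orthogonal_reflection_exists[OF u(1,2)] by auto
  define B where "B = H * A * H"
  have B: "B \<in> carrier_mat (Suc m) (Suc m)" using H Suc.prems by (simp add: B_def)
  have BT: "transpose_mat B = B" unfolding B_def using H Suc.prems
    by (simp add: transpose_mult[of _ "Suc m" "Suc m" _ "Suc m"] assoc_mult_mat[of _ "Suc m" "Suc m" _ "Suc m" _ "Suc m"])
  have A_eq: "A = H * B * H"
  proof -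
    have "H * B * H = (H * H) * A * (H * H)" unfolding B_def using H(1) Suc.prems(1)
      by (simp add: assoc_mult_mat[of _ "Suc m" "Suc m" _ "Suc m" _ "Suc m"])
    then show ?thesis using H Suc.prems by simp
  qed
  have "B *\<^sub>v unit_vec (Suc m) 0 = H *\<^sub>v (A *\<^sub>v (H *\<^sub>v unit_vec (Suc m) 0))"
    unfolding B_def using H Suc.prems
    by (simp add: assoc_mult_mat_vec[of _ "Suc m" "Suc m" _ "Suc m"])
  also have hu: "H *\<^sub>v unit_vec (Suc m) 0 = u" using H by (simp add: mult_mat_unit_vec[of _ "Suc m" "Suc m"])
  also have "H *\<^sub>v (A *\<^sub>v u) = l \<cdot>\<^sub>v (H *\<^sub>v u)" using u H by (simp add: mult_mat_vec)
  also have "H *\<^sub>v u = H *\<^sub>v (H *\<^sub>v unit_vec (Suc m) 0)" by (simp add: hu)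
  also have "\<dots> = (H * H) *\<^sub>v unit_vec (Suc m) 0"
    using H(1) by (simp add: assoc_mult_mat_vec[of _ "Suc m" "Suc m" _ "Suc m"])
  also have "\<dots> = unit_vec (Suc m) 0" using H by simp
  finally have "col B 0 = l \<cdot>\<^sub>v unit_vec (Suc m) 0" using B by (simp add: mult_mat_unit_vec[of _ "Suc m" "Suc m"])
  then have B0: "B $$ (i, 0) = (if i = 0 then l else 0)" if "i < Suc m" for i
    using that B by (auto simp: vec_eq_iff col_def)
  then have B0': "B $$ (0, i) = (if i = 0 then l else 0)" if "i < Suc m" for i
    using that B BT by (metis index_transpose_mat(1) carrier_matD zero_less_Suc)
  define C where "C = mat m m (\<lambda>(i, j). B $$ (Suc i, Suc j))"
  have C: "C \<in> carrier_mat m m" by (simp add: C_def)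
  have BC: "B $$ (i, j) = B $$ (j, i)" if "i < Suc m" "j < Suc m" for i j
    using that B BT by (metis index_transpose_mat(1) carrier_matD)
  have "transpose_mat C = C" by (rule eq_matI) (auto simp: C_def intro: BC)
  then obtain Q d where Q: "Q \<in> carrier_mat m m" "Q * transpose_mat Q = 1\<^sub>m m"
    "transpose_mat Q * Q = 1\<^sub>m m" "C = Q * mat_diag m d * transpose_mat Q"
    using Suc.IH[OF C] by blast
  define L where "L = mat 1 1 (\<lambda>_. l)"
  \<comment> \<open>\<open>case_nat l d\<close> puts the split-off eigenvalue \<open>l\<close> at
    index 0 and shifts those of \<open>C\<close> by one.\<close>
  define D where "D = mat_diag (Suc m) (case_nat l d)"
  define P where "P = four_block_mat (1\<^sub>m 1) (0\<^sub>m 1 m) (0\<^sub>m m 1) Q"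
  have P: "P \<in> carrier_mat (Suc m) (Suc m)" using Q by (intro carrier_matI) (auto simp: P_def)
  have PT: "transpose_mat P = four_block_mat (1\<^sub>m 1) (0\<^sub>m 1 m) (0\<^sub>m m 1) (transpose_mat Q)"
    unfolding P_def using Q by (subst transpose_four_block_mat) auto
  have D_eq: "D = four_block_mat L (0\<^sub>m 1 m) (0\<^sub>m m 1) (mat_diag m d)"
    by (rule eq_matI) (auto simp: D_def L_def mat_diag_def split: nat.splits)
  have B_eq: "B = four_block_mat L (0\<^sub>m 1 m) (0\<^sub>m m 1) C"
  proof (rule eq_matI)
    fix i j
    assume "i < dim_row (four_block_mat L (0\<^sub>m 1 m) (0\<^sub>m m 1) C)"
      "j < dim_col (four_block_mat L (0\<^sub>m 1 m) (0\<^sub>m m 1) C)"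
    then have "i < Suc m" "j < Suc m" using C by (auto simp: L_def)
    then show "B $$ (i, j) = four_block_mat L (0\<^sub>m 1 m) (0\<^sub>m m 1) C $$ (i, j)"
      using B0[of i] B0'[of j] by (cases i; cases j) (auto simp: L_def C_def)
  qed (use B C in \<open>auto simp: L_def\<close>)
  have one: "four_block_mat (1\<^sub>m 1) (0\<^sub>m 1 m) (0\<^sub>m m 1) (1\<^sub>m m) = (1\<^sub>m (Suc m) :: real mat)"
    by (rule eq_matI) auto
  have PPT: "P * transpose_mat P = 1\<^sub>m (Suc m)" unfolding PT unfolding P_def using Q
    by (subst mult_four_block_mat[of _ 1 1 _ m _ m _ _ 1 _ m]) (auto simp: one)
  have PTP: "transpose_mat P * P = 1\<^sub>m (Suc m)" unfolding PT unfolding P_def using Q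
    by (subst mult_four_block_mat[of _ 1 1 _ m _ m _ _ 1 _ m]) (auto simp: one)
  define E where "E = Q * mat_diag m d"
  have E: "E \<in> carrier_mat m m" unfolding E_def using mult_carrier_mat[OF Q(1) mat_diag_dim] .
  have C_eq: "C = E * transpose_mat Q" using Q(4) by (simp add: E_def)
  have PD: "P * D = four_block_mat L (0\<^sub>m 1 m) (0\<^sub>m m 1) E"
    unfolding P_def D_eq E_def using Q
    by (subst mult_four_block_mat[of _ 1 1 _ m _ m _ _ 1 _ m])
      (auto simp: L_def left_mult_zero_mat[OF mat_diag_dim])
  have PDP: "P * D * transpose_mat P = B"
    unfolding PD PT B_eq C_eq using Q(1) E
    by (subst mult_four_block_mat[of _ 1 1 _ m _ m _ _ 1 _ m]) (auto simp: L_def)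
  define R where "R = H * P"
  have R: "R \<in> carrier_mat (Suc m) (Suc m)" using H P by (simp add: R_def)
  have D: "D \<in> carrier_mat (Suc m) (Suc m)" by (simp add: D_def)
  have RT: "transpose_mat R = transpose_mat P * H"
    unfolding R_def using H P by (subst transpose_mult[of _ "Suc m" "Suc m" _ "Suc m"]) auto
  have PT': "transpose_mat P \<in> carrier_mat (Suc m) (Suc m)" using P by simp
  have "R * transpose_mat R = H * (P * transpose_mat P) * H" unfolding RT unfolding R_def using H(1) P PT'
    by (simp add: assoc_mult_mat[of _ "Suc m" "Suc m" _ "Suc m" _ "Suc m"])
  then have 1: "R * transpose_mat R = 1\<^sub>m (Suc m)" using PPT H by simp
  have "transpose_mat R * R = transpose_mat P * (H * H) * P" unfolding RT unfolding R_def using H(1) P PT'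
    by (simp add: assoc_mult_mat[of _ "Suc m" "Suc m" _ "Suc m" _ "Suc m"])
  then have 2: "transpose_mat R * R = 1\<^sub>m (Suc m)" using PTP PT' H by simp
  have "R * D * transpose_mat R = H * (P * D * transpose_mat P) * H" unfolding RT unfolding R_def
    using H(1) P PT' D by (simp add: assoc_mult_mat[of _ "Suc m" "Suc m" _ "Suc m" _ "Suc m"])
  then have "A = R * D * transpose_mat R" using A_eq PDP by simp
  with 1 2 R show ?case unfolding D_def by blast
qed

section \<open>Positive inertia read off a diagonalisation\<close>

lemma order_prod_linear:
  fixes d :: "nat \<Rightarrow> 'a::field"
  shows "order x (\<Prod>i<n. [:- d i, 1:]) = card {i. i < n \<and> d i = x}"
proof (induction n)
  case (Suc n)
  have "order x [:- d n, 1:] = (if d n = x then 1 else 0)"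
    using order_power_n_n[of x 1] by (auto intro: order_0I)
  moreover have "order x (\<Prod>i<Suc n. [:- d i, 1:]) = order x (\<Prod>i<n. [:- d i, 1:]) + order x [:- d n, 1:]"
    unfolding prod.lessThan_Suc by (rule order_mult) (simp add: prod_zero_iff del: mult_pCons_right)
  moreover have "card {i. i < Suc n \<and> d i = x} = card {i. i < n \<and> d i = x} + (if d n = x then 1 else 0)"
  proof -
    have "{i. i < Suc n \<and> d i = x} = (if d n = x then insert n else id) {i. i < n \<and> d i = x}"
      by (auto simp: less_Suc_eq)
    then show ?thesis by simp
  qed
  ultimately show ?case using Suc by presburger
qed simp

text \<open>Similarity makes the characteristic polynomial a product of linear factors, so the
  multiplicity of \<open>x\<close> is the size of the fibre of \<open>d\<close> over
  \<open>x\<close>. The fibres over the positive eigenvalues are disjoint, and their union is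
  counted.\<close>

lemma positive_inertia_spectral:
  assumes Q: "Q \<in> carrier_mat n n" "Q * transpose_mat Q = 1\<^sub>m n" "transpose_mat Q * Q = 1\<^sub>m n"
    and A_eq: "A = Q * mat_diag n d * transpose_mat Q"
  shows "positive_inertia A = card {i. i < n \<and> 0 < d i}"
proof -
  have A: "A \<in> carrier_mat n n"
    unfolding A_eq using Q(1) mult_carrier_mat[OF mult_carrier_mat[OF Q(1) mat_diag_dim]] by simp
  have "similar_mat A (mat_diag n d)"
    unfolding similar_mat_def similar_mat_wit_def
    using Q A A_eq by (intro exI[of _ Q] exI[of _ "transpose_mat Q"]) (auto simp: Let_def)
  then have "char_poly A = char_poly (mat_diag n d)" by (rule char_poly_similar)
  also have "\<dots> = (\<Prod>a\<leftarrow>diag_mat (mat_diag n d). [:- a, 1:])"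
    by (rule char_poly_upper_triangular[of _ n]) (auto simp: mat_diag_def)
  also have "diag_mat (mat_diag n d) = map d [0..<n]"
    by (auto simp: diag_mat_def mat_diag_def)
  also have "(\<Prod>a\<leftarrow>map d [0..<n]. [:- a, 1:]) = (\<Prod>i<n. [:- d i, 1:])"
    by (induction n) (auto simp: mult.commute)
  finally have cp: "char_poly A = (\<Prod>i<n. [:- d i, 1:])" .
  have ev: "eigenvalue A x \<longleftrightarrow> x \<in> d ` {..<n}" for x
    unfolding eigenvalue_root_char_poly[OF A] cp by (auto simp: poly_prod)
  have "positive_inertia A = (\<Sum>x | x \<in> d ` {..<n} \<and> 0 < x. card {i. i < n \<and> d i = x})"
    unfolding positive_inertia_def ev by (simp add: cp order_prod_linear)
  also have "\<dots> = card (\<Union>x\<in>{x. x \<in> d ` {..<n} \<and> 0 < x}. {i. i < n \<and> d i = x})"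
    by (subst card_UN_disjoint) auto
  also have "(\<Union>x\<in>{x. x \<in> d ` {..<n} \<and> 0 < x}. {i. i < n \<and> d i = x}) = {i. i < n \<and> 0 < d i}"
    by auto
  finally show ?thesis .
qed

section \<open>Coordinate subspaces on which the quadratic form vanishes\<close>

text \<open>A dimension count: the vectors supported on \<open>I\<close> cannot all escape
  \<open>card J\<close> linear conditions. It is applied to the transpose of \<open>Q\<close>, with
  \<open>J\<close> the eigendirections whose coordinates are to vanish.\<close>

lemma supported_vec_in_kernel_exists:
  fixes M :: "'a::field mat"
  assumes M: "M \<in> carrier_mat n n" and I: "I \<subseteq> {..<n}" and J: "J \<subseteq> {..<n}" and c: "card J < card I"
  shows "\<exists>a. a \<in> carrier_vec n \<and> a \<noteq> 0\<^sub>v n \<and> (\<forall>i<n. i \<notin> I \<longrightarrow> a $ i = 0) \<and> (\<forall>j\<in>J. (M *\<^sub>v a) $ j = 0)"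
proof -
  have fin: "finite J" "finite I" using I J finite_subset by blast+
  obtain a where a: "\<exists>j\<in>I. a j \<noteq> 0" "\<forall>j. j \<notin> I \<longrightarrow> a j = 0"
    "\<forall>i\<in>J. (\<Sum>j\<in>I. M $$ (i, j) * a j) = 0"
    using underdetermined_system_solution[OF fin c, of "\<lambda>i j. M $$ (i, j)"] by blast
  have "(M *\<^sub>v vec n a) $ i = 0" if "i \<in> J" for i
  proof -
    have "(M *\<^sub>v vec n a) $ i = (\<Sum>j = 0..<n. M $$ (i, j) * a j)"
      using that J M by (auto simp: scalar_prod_def)
    also have "\<dots> = (\<Sum>j\<in>I. M $$ (i, j) * a j)"
      using I a(2) by (intro sum.mono_neutral_right) auto
    finally show ?thesis using a(3) that by simp
  qed
  moreover have "vec n a \<noteq> 0\<^sub>v n" using a(1) I by (metis index_vec index_zero_vec(1) lessThan_iff subsetD)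
  ultimately show ?thesis using a(2) by (intro exI[of _ "vec n a"]) auto
qed

lemma quadratic_form_spectral:
  fixes Q :: "real mat"
  assumes Q: "Q \<in> carrier_mat n n" and A_eq: "A = Q * mat_diag n d * transpose_mat Q"
    and a: "a \<in> carrier_vec n"
  shows "a \<bullet> (A *\<^sub>v a) = (\<Sum>i<n. d i * ((transpose_mat Q *\<^sub>v a) $ i)\<^sup>2)"
proof -
  define y where "y = transpose_mat Q *\<^sub>v a"
  have y: "y \<in> carrier_vec n" using Q a by (simp add: y_def)
  have "A *\<^sub>v a = Q *\<^sub>v (mat_diag n d *\<^sub>v y)" unfolding A_eq y_def using Q a
    by (simp add: assoc_mult_mat_vec[of _ n n _ n])
  then have "a \<bullet> (A *\<^sub>v a) = y \<bullet> (mat_diag n d *\<^sub>v y)" unfolding y_def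
    using transpose_vec_mult_scalar[OF Q _ a, of "mat_diag n d *\<^sub>v y"] y
    by (simp add: y_def mult_mat_vec_carrier[of _ n n])
  also have "mat_diag n d *\<^sub>v y = vec n (\<lambda>i. d i * y $ i)"
    using y by (auto simp: mat_diag_def scalar_prod_def sum.delta' if_distrib[of "\<lambda>x. x * _"] cong: if_cong)
  also have "y \<bullet> \<dots> = (\<Sum>i<n. d i * (y $ i)\<^sup>2)"
    using y by (simp add: scalar_prod_def power2_eq_square atLeast0LessThan algebra_simps)
  finally show ?thesis unfolding y_def .
qed

lemma isotropic_quadratic_form:
  fixes A :: "'a::comm_ring_1 mat"
  assumes A: "A \<in> carrier_mat n n" and iso: "\<And>i j. i \<in> I \<Longrightarrow> j \<in> I \<Longrightarrow> A $$ (i, j) = 0"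
    and a: "a \<in> carrier_vec n" "\<forall>i<n. i \<notin> I \<longrightarrow> a $ i = 0"
  shows "a \<bullet> (A *\<^sub>v a) = 0"
proof -
  have "a $ i * (A $$ (i, j) * a $ j) = 0" if "i < n" "j < n" for i j
    using a(2) iso[of i j] that by (cases "i \<in> I"; cases "j \<in> I") auto
  then have "a $ i * (\<Sum>j = 0..<n. A $$ (i, j) * a $ j) = 0" if "i < n" for i
    using that by (simp add: sum_distrib_left)
  then show ?thesis using A a by (simp add: scalar_prod_def)
qed

text \<open>If \<open>I\<close> were larger than the number of non-positive eigenvalues, some
  nonzero vector supported on \<open>I\<close> would have coordinates only along positive ones. The
  form vanishes on it but is a sum of nonnegative terms, so every coordinate is zero, a
  contradiction.\<close>

lemma positive_inertia_le_isotropic: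
  fixes A :: "real mat"
  assumes A: "A \<in> carrier_mat n n" and sym: "transpose_mat A = A" and I: "I \<subseteq> {..<n}"
    and iso: "\<And>i j. i \<in> I \<Longrightarrow> j \<in> I \<Longrightarrow> A $$ (i, j) = 0"
  shows "positive_inertia A + card I \<le> n"
proof (rule ccontr)
  obtain Q d where Q: "Q \<in> carrier_mat n n" "Q * transpose_mat Q = 1\<^sub>m n" "transpose_mat Q * Q = 1\<^sub>m n"
    and A_eq: "A = Q * mat_diag n d * transpose_mat Q"
    using real_symmetric_spectral[OF A sym] by blast
  have pos: "positive_inertia A = card {i. i < n \<and> 0 < d i}"
    by (rule positive_inertia_spectral[OF Q A_eq])
  have "{..<n} = {i. i < n \<and> 0 < d i} \<union> {i. i < n \<and> \<not> 0 < d i}" by auto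
  then have "n = card ({i. i < n \<and> 0 < d i} \<union> {i. i < n \<and> \<not> 0 < d i})" by (metis card_lessThan)
  also have "\<dots> = positive_inertia A + card {i. i < n \<and> \<not> 0 < d i}"
    unfolding pos by (rule card_Un_disjoint) auto
  finally have n: "n = positive_inertia A + card {i. i < n \<and> \<not> 0 < d i}" .
  assume "\<not> positive_inertia A + card I \<le> n"
  with n have "card {i. i < n \<and> \<not> 0 < d i} < card I" by linarith
  moreover have "transpose_mat Q \<in> carrier_mat n n" "{i. i < n \<and> \<not> 0 < d i} \<subseteq> {..<n}" using Q by auto
  ultimately obtain a where a: "a \<in> carrier_vec n" "a \<noteq> 0\<^sub>v n" "\<forall>i<n. i \<notin> I \<longrightarrow> a $ i = 0"
    and ay: "\<forall>j\<in>{i. i < n \<and> \<not> 0 < d i}. (transpose_mat Q *\<^sub>v a) $ j = 0"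
    using supported_vec_in_kernel_exists[OF _ I] by blast
  define y where "y = transpose_mat Q *\<^sub>v a"
  have y: "y \<in> carrier_vec n" using Q a by (simp add: y_def)
  have "(\<Sum>i<n. d i * (y $ i)\<^sup>2) = 0"
    using quadratic_form_spectral[OF Q(1) A_eq a(1)] isotropic_quadratic_form[OF A iso a(1,3)]
    by (simp add: y_def)
  moreover have nn: "0 \<le> d i * (y $ i)\<^sup>2" if "i \<in> {..<n}" for i
    using ay that by (cases "0 < d i") (auto simp: y_def)
  ultimately have *: "d i * (y $ i)\<^sup>2 = 0" if "i < n" for i
    using sum_nonneg_eq_0_iff[of "{..<n}" "\<lambda>i. d i * (y $ i)\<^sup>2"] that by auto
  have "y $ i = 0" if "i < n" for i
    using *[OF that] ay that by (cases "0 < d i") (auto simp: y_def)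
  then have "y = 0\<^sub>v n" using y by (intro eq_vecI) auto
  then have "Q *\<^sub>v y = 0\<^sub>v n" using Q by (intro eq_vecI) auto
  moreover have "Q *\<^sub>v y = a" unfolding y_def using Q a
    by (metis assoc_mult_mat_vec one_mult_mat_vec transpose_carrier_mat)
  ultimately show False using a by simp
qed

text \<open>If \<open>I\<close> were larger than the number of positive eigenvalues, some nonzero
  \<open>a\<close> supported on \<open>I\<close> would have coordinates only along non-positive
  ones. Vanishing of the form now leaves coordinates for the eigenvalue 0 free, so it gives
  \<open>A *\<^sub>v a = 0\<^sub>v n\<close> rather than \<open>a = 0\<^sub>v n\<close>; assumption
  \<open>inj\<close> closes this gap.\<close>

lemma positive_inertia_ge_isotropic:
  fixes A :: "real mat"
  assumes A: "A \<in> carrier_mat n n" and sym: "transpose_mat A = A" and I: "I \<subseteq> {..<n}"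
    and iso: "\<And>i j. i \<in> I \<Longrightarrow> j \<in> I \<Longrightarrow> A $$ (i, j) = 0"
    and inj: "\<And>a. a \<in> carrier_vec n \<Longrightarrow> \<forall>i<n. i \<notin> I \<longrightarrow> a $ i = 0 \<Longrightarrow> A *\<^sub>v a = 0\<^sub>v n \<Longrightarrow> a = 0\<^sub>v n"
  shows "card I \<le> positive_inertia A"
proof (rule ccontr)
  obtain Q d where Q: "Q \<in> carrier_mat n n" "Q * transpose_mat Q = 1\<^sub>m n" "transpose_mat Q * Q = 1\<^sub>m n"
    and A_eq: "A = Q * mat_diag n d * transpose_mat Q"
    using real_symmetric_spectral[OF A sym] by blast
  have pos: "positive_inertia A = card {i. i < n \<and> 0 < d i}"
    by (rule positive_inertia_spectral[OF Q A_eq])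
  assume "\<not> card I \<le> positive_inertia A"
  then have "card {i. i < n \<and> 0 < d i} < card I" using pos by simp
  moreover have "transpose_mat Q \<in> carrier_mat n n" "{i. i < n \<and> 0 < d i} \<subseteq> {..<n}" using Q by auto
  ultimately obtain a where a: "a \<in> carrier_vec n" "a \<noteq> 0\<^sub>v n" "\<forall>i<n. i \<notin> I \<longrightarrow> a $ i = 0"
    and ay: "\<forall>j\<in>{i. i < n \<and> 0 < d i}. (transpose_mat Q *\<^sub>v a) $ j = 0"
    using supported_vec_in_kernel_exists[OF _ I] by blast
  define y where "y = transpose_mat Q *\<^sub>v a"
  have y: "y \<in> carrier_vec n" using Q a by (simp add: y_def)
  have "(\<Sum>i<n. - (d i * (y $ i)\<^sup>2)) = 0"
    using quadratic_form_spectral[OF Q(1) A_eq a(1)] isotropic_quadratic_form[OF A iso a(1,3)]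
    by (simp add: y_def sum_negf)
  moreover have nn: "0 \<le> - (d i * (y $ i)\<^sup>2)" if "i \<in> {..<n}" for i
    using ay that by (cases "0 < d i") (auto simp: y_def mult_nonpos_nonneg)
  ultimately have *: "- (d i * (y $ i)\<^sup>2) = 0" if "i < n" for i
    using sum_nonneg_eq_0_iff[of "{..<n}" "\<lambda>i. - (d i * (y $ i)\<^sup>2)"] that by auto
  have "mat_diag n d *\<^sub>v y = vec n (\<lambda>i. d i * y $ i)"
    using y by (auto simp: mat_diag_def scalar_prod_def sum.delta' if_distrib[of "\<lambda>x. x * _"] cong: if_cong)
  also have "\<dots> = 0\<^sub>v n" using * by (intro eq_vecI) auto
  finally have "Q *\<^sub>v (mat_diag n d *\<^sub>v y) = 0\<^sub>v n" using Q by (intro eq_vecI) auto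
  moreover have "A *\<^sub>v a = Q *\<^sub>v (mat_diag n d *\<^sub>v y)" unfolding A_eq y_def using Q a
    by (simp add: assoc_mult_mat_vec[of _ n n _ n])
  ultimately show False using inj[OF a(1,3)] a(2) by simp
qed

section \<open>Triangular matchings and inertia of weighted graphs\<close>

text \<open>
  The rank \<open>r\<close> orders \<open>X\<close> so that the block of the adjacency matrix between \<open>X\<close> and \<open>Y\<close> is triangular
  with non-zero diagonal.
\<close>

definition triangular_matching :: "'b rel \<Rightarrow> 'b set \<Rightarrow> 'b set \<Rightarrow> bool" where
  "triangular_matching E X Y \<longleftrightarrow>
     (\<exists>(\<mu> :: 'b \<Rightarrow> 'b) (r :: 'b \<Rightarrow> nat). finite X \<and> \<mu> ` X = Y \<and> (\<forall>x\<in>X. (x, \<mu> x) \<in> E) \<and>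
       (\<forall>x\<in>X. \<forall>z\<in>X. (x, z) \<notin> E \<and> (x \<noteq> z \<longrightarrow> (x, \<mu> z) \<in> E \<longrightarrow> r z < r x)))"

lemma triangular_matching_singleton:
  "(x, y) \<in> E \<Longrightarrow> (x, x) \<notin> E \<Longrightarrow> triangular_matching E {x} {y}"
  unfolding triangular_matching_def by (intro exI[of _ "\<lambda>_. y"]) auto

text \<open>Two triangular blocks form a block triangular one when no vertex of \<open>X\<close>
  meets \<open>Y'\<close>. Arcs between \<open>X'\<close> and \<open>Y\<close> are harmless, because
  the ranks on \<open>X'\<close> are shifted above all those on \<open>X\<close>.\<close>

lemma triangular_matching_Un:
  assumes "triangular_matching E X Y" "triangular_matching E X' Y'"
    and cross: "\<And>x z. x \<in> X \<Longrightarrow> z \<in> X' \<Longrightarrow> (x, z) \<notin> E \<and> (z, x) \<notin> E"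
    and up: "\<And>x y. x \<in> X \<Longrightarrow> y \<in> Y' \<Longrightarrow> (x, y) \<notin> E"
  shows "triangular_matching E (X \<union> X') (Y \<union> Y')"
proof -
  obtain \<mu> r where m: "finite X" "\<mu> ` X = Y" "\<forall>x\<in>X. (x, \<mu> x) \<in> E"
    "\<forall>x\<in>X. \<forall>z\<in>X. (x, z) \<notin> E \<and> (x \<noteq> z \<longrightarrow> (x, \<mu> z) \<in> E \<longrightarrow> r z < (r x :: nat))"
    using assms(1) unfolding triangular_matching_def by blast
  obtain \<mu>' r' where m': "finite X'" "\<mu>' ` X' = Y'" "\<forall>x\<in>X'. (x, \<mu>' x) \<in> E"
    "\<forall>x\<in>X'. \<forall>z\<in>X'. (x, z) \<notin> E \<and> (x \<noteq> z \<longrightarrow> (x, \<mu>' z) \<in> E \<longrightarrow> r' z < (r' x :: nat))"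
    using assms(2) unfolding triangular_matching_def by blast
  \<comment> \<open>A common vertex of \<open>X\<close> and \<open>X'\<close> would be adjacent to
    its own partner in \<open>Y'\<close>, against \<open>up\<close>.\<close>
  have disj: "x \<notin> X" if "x \<in> X'" for x using up m' that by blast
  define N where "N = Suc (Max (insert 0 (r ` X)))"
  have N: "r x < N" if "x \<in> X" for x unfolding N_def using that m(1) by (simp add: less_Suc_eq_le)
  define \<nu> where "\<nu> x = (if x \<in> X then \<mu> x else \<mu>' x)" for x
  define t where "t x = (if x \<in> X then r x else N + r' x)" for x
  have "\<nu> ` (X \<union> X') = Y \<union> Y'" using m(2) m'(2) disj by (force simp: \<nu>_def image_iff)
  moreover have "\<forall>x\<in>X \<union> X'. (x, \<nu> x) \<in> E" using m(3) m'(3) by (auto simp: \<nu>_def)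
  moreover have "(x, z) \<notin> E \<and> (x \<noteq> z \<longrightarrow> (x, \<nu> z) \<in> E \<longrightarrow> t z < t x)"
    if "x \<in> X \<union> X'" "z \<in> X \<union> X'" for x z
  proof (cases "x \<in> X"; cases "z \<in> X")
    assume "x \<in> X" "z \<notin> X"
    then show ?thesis using that cross up m'(2) by (auto simp: \<nu>_def)
  next
    assume "x \<notin> X" "z \<in> X"
    then show ?thesis using that cross N[of z] by (auto simp: t_def)
  qed (use that m(4) m'(4) in \<open>auto simp: \<nu>_def t_def\<close>)
  ultimately show ?thesis unfolding triangular_matching_def using m(1) m'(1)
    by (intro exI[of _ \<nu>] exI[of _ t]) auto
qed

text \<open>Transport along an induced embedding of \<open>V\<close>. It serves to reverse a cycle,
  to place cycles in \<open>infty_graph\<close>, and to move from there into the given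
  graph.\<close>

lemma triangular_matching_image:
  assumes "triangular_matching E X Y" and inj: "inj_on f V" and XY: "X \<union> Y \<subseteq> V"
    and E': "\<And>a b. a \<in> V \<Longrightarrow> b \<in> V \<Longrightarrow> (f a, f b) \<in> E' \<longleftrightarrow> (a, b) \<in> E"
  shows "triangular_matching E' (f ` X) (f ` Y)"
proof -
  obtain \<mu> r where m: "finite X" "\<mu> ` X = Y" "\<forall>x\<in>X. (x, \<mu> x) \<in> E"
    "\<forall>x\<in>X. \<forall>z\<in>X. (x, z) \<notin> E \<and> (x \<noteq> z \<longrightarrow> (x, \<mu> z) \<in> E \<longrightarrow> r z < (r x :: nat))"
    using assms(1) unfolding triangular_matching_def by blast
  define g where "g = the_inv_into V f"
  have g: "g (f x) = x" if "x \<in> X" for x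
    unfolding g_def using the_inv_into_f_f[OF inj] that XY by auto
  have X: "x \<in> V" "\<mu> x \<in> V" if "x \<in> X" for x using that XY m(2) by auto
  have "(f \<circ> \<mu> \<circ> g) ` f ` X = f ` Y" unfolding m(2)[symmetric] image_image
    using g by (intro image_cong) auto
  then show ?thesis unfolding triangular_matching_def
    using m X by (intro exI[of _ "f \<circ> \<mu> \<circ> g"] exI[of _ "r \<circ> g"]) (auto simp: E' g)
qed

lemma adjacency_matrix_carrier: "adjacency_matrix n v G w \<in> carrier_mat n n"
  by (simp add: adjacency_matrix_def)

lemma transpose_adjacency_matrix:
  assumes "pair_graph G"
  shows "transpose_mat (adjacency_matrix n v G w) = adjacency_matrix n v G w"
proof -
  interpret pair_graph G by fact
  show ?thesis
    by (rule eq_matI) (auto simp: adjacency_matrix_def insert_commute dest: arcs_symmetric)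
qed

lemma card_indices_bij_betw:
  assumes "bij_betw v {..<n} V" "X \<subseteq> V"
  shows "card {i. i < n \<and> v i \<in> X} = card X"
proof -
  have "bij_betw v {i. i < n \<and> v i \<in> X} X"
    using assms by (auto simp: bij_betw_def inj_on_def)
  then show ?thesis by (rule bij_betw_same_card)
qed

text \<open>Given a nonzero kernel vector supported on \<open>X\<close>, take a vertex
  \<open>v i\<close> of maximal rank in its support and read the row of its partner. Any other
  support vertex adjacent to that partner would have larger rank, so the row reduces to one product
  of a positive weight and a nonzero entry.\<close>

lemma positive_inertia_ge_triangular_matching:
  assumes G: "weighted_graph G w" and v: "bij_betw v {..<n} (pverts G)"
    and tm: "triangular_matching (parcs G) X Y"
  shows "card X \<le> positive_inertia (adjacency_matrix n v G w)"
proof -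
  interpret pair_graph G using G by (simp add: weighted_graph_def)
  define A where "A = adjacency_matrix n v G w"
  define I where "I = {i. i < n \<and> v i \<in> X}"
  obtain \<mu> and r :: "'a \<Rightarrow> nat" where m: "\<forall>x\<in>X. (x, \<mu> x) \<in> parcs G"
    "\<forall>x\<in>X. \<forall>z\<in>X. (x, z) \<notin> parcs G \<and> (x \<noteq> z \<longrightarrow> (x, \<mu> z) \<in> parcs G \<longrightarrow> r z < r x)"
    using tm unfolding triangular_matching_def by blast
  have X: "X \<subseteq> pverts G" using m(1) in_arcsD1 by blast
  have "card I \<le> positive_inertia A"
  proof (rule positive_inertia_ge_isotropic)
    show "A \<in> carrier_mat n n" by (simp add: A_def adjacency_matrix_carrier)
    show "transpose_mat A = A" unfolding A_def by (rule transpose_adjacency_matrix) unfold_locales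
    show "I \<subseteq> {..<n}" by (auto simp: I_def)
    show "A $$ (i, j) = 0" if "i \<in> I" "j \<in> I" for i j
      using that m(2) by (auto simp: A_def I_def adjacency_matrix_def)
    fix a assume a: "a \<in> carrier_vec n" "\<forall>i<n. i \<notin> I \<longrightarrow> a $ i = 0" and Aa: "A *\<^sub>v a = 0\<^sub>v n"
    show "a = 0\<^sub>v n"
    proof (rule ccontr)
      define S where "S = {i. i < n \<and> a $ i \<noteq> 0}"
      assume "a \<noteq> 0\<^sub>v n"
      then have "S \<noteq> {}" using a(1) by (auto simp: S_def)
      moreover have "finite S" by (simp add: S_def)
      ultimately have "Max ((r \<circ> v) ` S) \<in> (r \<circ> v) ` S" by (intro Max_in) auto
      then obtain i where i: "i \<in> S" "r (v i) = Max ((r \<circ> v) ` S)" by auto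
      have max: "r (v j) \<le> r (v i)" if "j \<in> S" for j
        unfolding i(2) using that \<open>finite S\<close> by (intro Max_ge) auto
      have SI: "j < n \<and> v j \<in> X" if "j \<in> S" for j using that a(2) by (auto simp: S_def I_def)
      have "\<mu> (v i) \<in> pverts G" using m(1) SI[OF i(1)] in_arcsD2 by blast
      then obtain k where k: "k < n" "v k = \<mu> (v i)"
        using v by (auto simp: bij_betw_def) (metis imageE lessThan_iff)
      have "A $$ (k, j) * a $ j = 0" if "j \<in> {0..<n} - {i}" for j
      proof (cases "j \<in> S")
        case True
        have "v j \<noteq> v i" using that SI[OF i(1)] v by (auto simp: bij_betw_def dest: inj_onD)
        then have "(v j, v k) \<notin> parcs G" using max[OF True] m(2) SI[OF True] SI[OF i(1)] k by fastforce
        then have "(v k, v j) \<notin> parcs G" using arcs_symmetric by blast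
        then show ?thesis using that k by (simp add: A_def adjacency_matrix_def)
      qed (use that in \<open>auto simp: S_def\<close>)
      then have "(\<Sum>j\<in>{0..<n} - {i}. A $$ (k, j) * a $ j) = 0" by (intro sum.neutral) blast
      then have "(A *\<^sub>v a) $ k = A $$ (k, i) * a $ i"
        using k a(1) SI[OF i(1)]
        by (simp add: A_def adjacency_matrix_carrier[THEN carrier_matD(1)]
            adjacency_matrix_carrier[THEN carrier_matD(2)] scalar_prod_def sum.remove[of "{0..<n}" i])
      moreover have "(v k, v i) \<in> parcs G" using m(1) SI[OF i(1)] k arcs_symmetric by auto
      then have "0 < A $$ (k, i)" using G k SI[OF i(1)]
        by (auto simp: A_def adjacency_matrix_def weighted_graph_def uedges_def)
      ultimately show False using Aa k i by (simp add: S_def)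
    qed
  qed
  then show ?thesis using card_indices_bij_betw[OF v X] by (simp add: A_def I_def)
qed

lemma positive_inertia_le_independent:
  assumes G: "pair_graph G" and v: "bij_betw v {..<n} (pverts G)"
    and X: "X \<subseteq> pverts G" "\<And>x y. x \<in> X \<Longrightarrow> y \<in> X \<Longrightarrow> (x, y) \<notin> parcs G"
  shows "positive_inertia (adjacency_matrix n v G w) + card X \<le> n"
proof -
  have "positive_inertia (adjacency_matrix n v G w) + card {i. i < n \<and> v i \<in> X} \<le> n"
    using X(2) by (intro positive_inertia_le_isotropic adjacency_matrix_carrier
        transpose_adjacency_matrix[OF G]) (auto simp: adjacency_matrix_def)
  then show ?thesis using card_indices_bij_betw[OF v X(1)] by simp
qed

section \<open>Edge counts and the base of a bicyclic graph\<close>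

lemma connected_boundary_arc:
  assumes "pair_graph G" "Digraph_Component.connected (with_proj G)"
    and S: "S \<subseteq> pverts G" "S \<noteq> {}" "S \<noteq> pverts G"
  shows "\<exists>s\<in>S. \<exists>y\<in>pverts G - S. (s, y) \<in> parcs G"
proof (rule ccontr)
  interpret pair_graph G by fact
  assume no: "\<not> ?thesis"
  obtain s y where sy: "s \<in> S" "y \<in> pverts G" "y \<notin> S" using S by blast
  have "strongly_connected (with_proj G)"
    using symmetric_connected_imp_strongly_connected[OF pair_sym_arcs assms(2)] .
  then have "s \<rightarrow>\<^sup>*\<^bsub>with_proj G\<^esub> y" using sy S by (auto simp: strongly_connected_def)
  then have "(s, y) \<in> rtrancl_on (pverts G) (parcs G)" by (simp add: reachable_def)
  then have "y \<in> S"
  proof (induction rule: rtrancl_on_induct)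
    case base then show ?case using sy by simp
  next
    case (step a b) then show ?case using no in_arcsD2 by blast
  qed
  with sy show False by simp
qed

lemma finite_uedges: "finite (parcs G) \<Longrightarrow> finite (uedges G)"
  by (simp add: uedges_def)

text \<open>Enlarge \<open>S\<close> one vertex at a time along a boundary arc. Each new vertex
  turns at least one edge, the one just used, into an edge inside the set.\<close>

lemma connected_card_edges_outside:
  assumes G: "pair_graph G" "Digraph_Component.connected (with_proj G)"
    and S: "S \<subseteq> pverts G" "S \<noteq> {}"
  shows "card (pverts G) \<le> card S + card {e \<in> uedges G. \<not> e \<subseteq> S}"
  using S
proof (induction "card (pverts G - S)" arbitrary: S)
  case 0
  interpret pair_graph G by fact
  have "pverts G - S = {}" using 0 pair_finite_verts by simp
  then have "S = pverts G" using 0 by auto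
  then show ?case by simp
next
  case (Suc k)
  interpret pair_graph G by fact
  have "S \<noteq> pverts G" using Suc.hyps(2) by auto
  then obtain s y where sy: "s \<in> S" "y \<in> pverts G" "y \<notin> S" "(s, y) \<in> parcs G"
    using connected_boundary_arc[OF G Suc.prems] by blast
  have fS: "finite S" using Suc.prems pair_finite_verts finite_subset by blast
  have "card (pverts G - insert y S) = k"
  proof -
    have "pverts G - S = insert y (pverts G - insert y S)" using sy by auto
    then show ?thesis using Suc.hyps(2) pair_finite_verts by (metis Diff_iff card_insert_disjoint finite_Diff insertCI nat.inject)
  qed
  then have "card (pverts G) \<le> card (insert y S) + card {e \<in> uedges G. \<not> e \<subseteq> insert y S}"
    using Suc.hyps(1)[of "insert y S"] Suc.prems sy by auto
  moreover have "card (insert y S) = Suc (card S)" using fS sy by simp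
  moreover have "card {e \<in> uedges G. \<not> e \<subseteq> insert y S} < card {e \<in> uedges G. \<not> e \<subseteq> S}"
  proof (rule psubset_card_mono)
    show "finite {e \<in> uedges G. \<not> e \<subseteq> S}" using finite_uedges[OF pair_finite_arcs] by simp
    have "{s, y} \<in> uedges G" using sy by (force simp: uedges_def)
    then have "{s, y} \<in> {e \<in> uedges G. \<not> e \<subseteq> S} - {e \<in> uedges G. \<not> e \<subseteq> insert y S}"
      using sy by simp
    moreover have "{e \<in> uedges G. \<not> e \<subseteq> insert y S} \<subseteq> {e \<in> uedges G. \<not> e \<subseteq> S}" by auto
    ultimately show "{e \<in> uedges G. \<not> e \<subseteq> insert y S} \<subset> {e \<in> uedges G. \<not> e \<subseteq> S}" by blast
  qed
  ultimately show ?case by simp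
qed

text \<open>Of the \<open>card (pverts G) + 1\<close> edges, at least
  \<open>card (pverts G) - card S\<close> are not inside \<open>S\<close>. This is the extremal
  count behind both facts about the base below.\<close>

lemma bicyclic_card_edges_inside:
  assumes G: "bicyclic G" and S: "S \<subseteq> pverts G" "S \<noteq> {}"
  shows "card {e \<in> uedges G. e \<subseteq> S} \<le> card S + 1"
proof -
  interpret pair_graph G using G by (simp add: bicyclic_def)
  have "uedges G = {e \<in> uedges G. e \<subseteq> S} \<union> {e \<in> uedges G. \<not> e \<subseteq> S}" by auto
  then have "card (uedges G) = card {e \<in> uedges G. e \<subseteq> S} + card {e \<in> uedges G. \<not> e \<subseteq> S}"
    using finite_uedges[OF pair_finite_arcs] by (metis (no_types, lifting) card_Un_disjoint disjoint_iff finite_Un mem_Collect_eq)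
  then show ?thesis using connected_card_edges_outside[OF _ _ S] G by (simp add: bicyclic_def)
qed

lemma uedges_arc:
  assumes "pair_graph G" "{a, b} \<in> uedges G"
  shows "(a, b) \<in> parcs G"
proof -
  interpret pair_graph G by fact
  show ?thesis using assms(2) arcs_symmetric by (auto simp: uedges_def doubleton_eq_iff)
qed

text \<open>Being bicyclic, \<open>H\<close> already has as many edges as its vertex set can span in
  \<open>G\<close>, so none is missing.\<close>

lemma base_induced:
  assumes G: "bicyclic G" and H: "base_of H G"
    and ab: "a \<in> pverts H" "b \<in> pverts H" "(a, b) \<in> parcs G"
  shows "(a, b) \<in> parcs H"
proof -
  interpret G: pair_graph G using G by (simp add: bicyclic_def)
  interpret H: pair_graph H using H by (simp add: base_of_def bicyclic_def)
  have sub: "pverts H \<subseteq> pverts G" "parcs H \<subseteq> parcs G" using H by (auto simp: base_of_def subgraph_def)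
  have "uedges H \<subseteq> {e \<in> uedges G. e \<subseteq> pverts H}"
    using sub H.in_arcsD1 H.in_arcsD2 by (auto simp: uedges_def)
  moreover have "card {e \<in> uedges G. e \<subseteq> pverts H} \<le> card (uedges H)"
    using bicyclic_card_edges_inside[OF G sub(1)] H ab by (auto simp: base_of_def bicyclic_def)
  ultimately have "uedges H = {e \<in> uedges G. e \<subseteq> pverts H}"
    using finite_uedges[OF G.pair_finite_arcs] by (intro card_seteq) auto
  then have "{a, b} \<in> uedges H" using ab by (force simp: uedges_def)
  then show ?thesis by (rule uedges_arc[rotated]) unfold_locales
qed

text \<open>The base cannot span \<open>G\<close>, since it would then equal \<open>G\<close> and
  contain the pendant vertex. Connectedness gives an arc leaving the base, to some \<open>y\<close>.
  The vertex \<open>y\<close> itself may have further neighbours outside the base; only its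
  neighbours inside matter later.\<close>

lemma base_attachment:
  assumes G: "bicyclic G" and H: "base_of H G" and z: "pendant_vertex G z"
  shows "\<exists>y s. y \<in> pverts G - pverts H \<and> s \<in> pverts H \<and> (y, s) \<in> parcs G \<and>
    (\<forall>t\<in>pverts H. (y, t) \<in> parcs G \<longrightarrow> t = s)"
proof -
  interpret G: pair_graph G using G by (simp add: bicyclic_def)
  interpret H: pair_graph H using H by (simp add: base_of_def bicyclic_def)
  have sub: "pverts H \<subseteq> pverts G" "parcs H \<subseteq> parcs G" using H by (auto simp: base_of_def subgraph_def)
  have ne: "pverts H \<noteq> {}" using H
    by (auto simp: base_of_def bicyclic_def Digraph_Component.connected_def strongly_connected_def mk_symmetric_def)
  have "pverts H \<noteq> pverts G"
  proof
    assume eq: "pverts H = pverts G"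
    then have "parcs H = parcs G" using sub base_induced[OF G H] G.in_arcsD1 G.in_arcsD2 by auto
    then have "pendant_vertex H z" using z eq by (simp add: pendant_vertex_def out_degree_def out_arcs_def)
    with H show False by (auto simp: base_of_def)
  qed
  then obtain s y where sy: "s \<in> pverts H" "y \<in> pverts G" "y \<notin> pverts H" "(s, y) \<in> parcs G"
    using connected_boundary_arc[OF _ _ sub(1) ne] G by (auto simp: bicyclic_def)
  have "t = s" if t: "t \<in> pverts H" "(y, t) \<in> parcs G" for t
  proof (rule ccontr)
    \<comment> \<open>With two neighbours in the base, adding \<open>y\<close> would give one vertex
      more but two edges more, exceeding the bound for \<open>insert y (pverts H)\<close>.\<close>
    assume "t \<noteq> s"
    have fin: "finite (uedges H)" "finite (uedges G)"
      using finite_uedges[OF H.pair_finite_arcs] finite_uedges[OF G.pair_finite_arcs] by auto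
    have notin: "{s, y} \<notin> uedges H" "{t, y} \<notin> uedges H"
      using sy H.in_arcsD1 H.in_arcsD2 by (auto simp: uedges_def doubleton_eq_iff)
    have "card (insert {s, y} (insert {t, y} (uedges H))) = card (uedges H) + 2"
    proof -
      have "{s, y} \<noteq> {t, y}" using \<open>t \<noteq> s\<close> by (auto simp: doubleton_eq_iff)
      then show ?thesis using notin fin by simp
    qed
    moreover have "card (insert {s, y} (insert {t, y} (uedges H))) \<le> card {e \<in> uedges G. e \<subseteq> insert y (pverts H)}"
    proof (rule card_mono)
      have "{s, y} \<in> uedges G" "{t, y} \<in> uedges G"
        using sy t G.arcs_symmetric by (force simp: uedges_def)+
      moreover have "uedges H \<subseteq> {e \<in> uedges G. e \<subseteq> pverts H}"
        using sub H.in_arcsD1 H.in_arcsD2 by (auto simp: uedges_def)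
      ultimately show "insert {s, y} (insert {t, y} (uedges H)) \<subseteq> {e \<in> uedges G. e \<subseteq> insert y (pverts H)}"
        using sy t by blast
    qed (use fin in simp)
    moreover have "card {e \<in> uedges G. e \<subseteq> insert y (pverts H)} \<le> card (insert y (pverts H)) + 1"
      using sy sub by (intro bicyclic_card_edges_inside[OF G]) auto
    moreover have "card (insert y (pverts H)) = card (pverts H) + 1" using sy H.pair_finite_verts by simp
    ultimately show False using H by (simp add: base_of_def bicyclic_def)
  qed
  with sy G.arcs_symmetric show ?thesis by blast
qed

section \<open>Cycles and the graphs \<open>\<infinity>(p, l, q)\<close>\<close>

text \<open>Removes \<open>mod\<close>, so that adjacency on a cycle becomes linear
  arithmetic.\<close>

lemma cycle_arcs_iff:
  assumes "3 \<le> m"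
  shows "(i, j) \<in> cycle_arcs m \<longleftrightarrow>
    i < m \<and> j < m \<and> (j = i + 1 \<or> i = j + 1 \<or> i = 0 \<and> j + 1 = m \<or> i + 1 = m \<and> j = 0)"
proof -
  have "(k + 1) mod m = (if k + 1 = m then 0 else k + 1)" if "k < m" for k using that by auto
  then show ?thesis by (auto simp: cycle_arcs_def split: if_splits)
qed

text \<open>Arithmetic for the independence of the left-hand sides: \<open>a\<close> and
  \<open>b\<close> are \<open>\<sigma> + 2 * t\<close> and \<open>\<sigma> + 2 * u\<close> modulo
  \<open>m\<close>, and \<open>2 * k < m\<close> rules out adjacency by wrapping around. The
  conclusion is absurd by parity.\<close>

lemma adjacent_shift:
  fixes a b t u k m \<sigma> :: nat
  assumes "b = a + 1 \<or> a = b + 1 \<or> a = 0 \<and> b + 1 = m \<or> a + 1 = m \<and> b = 0"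
    "a < m" "a = \<sigma> + 2 * t \<or> a + m = \<sigma> + 2 * t" "b < m" "b = \<sigma> + 2 * u \<or> b + m = \<sigma> + 2 * u"
    "t < k" "u < k" "2 * k < m"
  shows "2 * t = 2 * u + 1 \<or> 2 * u = 2 * t + 1"
  using assms by auto

text \<open>Arithmetic for triangularity: the successor \<open>c\<close> of the vertex with index
  \<open>u\<close> is adjacent to one other left-hand side at most, the next one. If
  \<open>2 * k\<close> were \<open>m\<close>, the last partner would also meet the first
  vertex.\<close>

lemma successor_shift:
  fixes a b c t u k m \<sigma> :: nat
  assumes "c = a + 1 \<or> a = c + 1 \<or> a = 0 \<and> c + 1 = m \<or> a + 1 = m \<and> c = 0" "t \<noteq> u"
    "a < m" "a = \<sigma> + 2 * t \<or> a + m = \<sigma> + 2 * t" "b < m" "b = \<sigma> + 2 * u \<or> b + m = \<sigma> + 2 * u"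
    "c < m" "c = b + 1 \<or> c + m = b + 1" "t < k" "u < k" "2 * k < m"
  shows "u < t"
  using assms by auto

text \<open>
  The matching pairs up consecutive vertices of the path \<open>\<sigma>, \<sigma> + 1, \<dots>, \<sigma> + 2 k - 1\<close>, read modulo \<open>m\<close>.
\<close>

lemma cycle_triangular_matching_forward:
  assumes m: "3 \<le> m" and \<sigma>: "1 \<le> \<sigma>" "\<sigma> \<le> m + 1" and k: "2 * k < m"
  shows "\<exists>X Y. triangular_matching (cycle_arcs m) X Y \<and> X \<subseteq> {..<m} \<and> card X = k \<and>
    (\<forall>x\<in>X. \<exists>t<k. x = \<sigma> + 2 * t \<or> x + m = \<sigma> + 2 * t) \<and>
    (\<forall>y\<in>Y. y < m \<and> (\<exists>t<k. y = \<sigma> + 2 * t + 1 \<or> y + m = \<sigma> + 2 * t + 1))"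
proof -
  \<comment> \<open>Reduction modulo \<open>m\<close>; one subtraction suffices because
    \<open>\<sigma> \<le> m + 1\<close> and \<open>2 * k < m\<close>.\<close>
  define h where "h t = (if \<sigma> + 2 * t < m then \<sigma> + 2 * t else \<sigma> + 2 * t - m)" for t
  define g where "g i = (if i + 1 = m then 0 else i + 1)" for i
  \<comment> \<open>On the values of \<open>h\<close> this recovers the unreduced position, so the
    rank increases along the path.\<close>
  define r where "r i = (if i < \<sigma> then i + m else i)" for i
  have h: "h t < m" "h t = \<sigma> + 2 * t \<or> h t + m = \<sigma> + 2 * t" "r (h t) = \<sigma> + 2 * t" if "t < k" for t
    using that \<sigma> k m by (auto simp: h_def r_def)
  have g: "(i, g i) \<in> cycle_arcs m" "g i < m" "g i = i + 1 \<or> g i + m = i + 1" if "i < m" for i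
    using that m by (simp_all add: g_def cycle_arcs_iff[OF m])
  have inj: "inj_on h {..<k}"
  proof (rule inj_onI)
    fix t u assume tu: "t \<in> {..<k}" "u \<in> {..<k}" "h t = h u"
    then have "\<sigma> + 2 * t = \<sigma> + 2 * u" using h(3) by (metis lessThan_iff)
    then show "t = u" by simp
  qed
  have indep: "(h t, h u) \<notin> cycle_arcs m" if "t < k" "u < k" for t u
  proof
    assume "(h t, h u) \<in> cycle_arcs m"
    then have "h u = h t + 1 \<or> h t = h u + 1 \<or> h t = 0 \<and> h u + 1 = m \<or> h t + 1 = m \<and> h u = 0"
      by (simp add: cycle_arcs_iff[OF m])
    then have "2 * t = 2 * u + 1 \<or> 2 * u = 2 * t + 1"
      using h(1,2)[OF that(1)] h(1,2)[OF that(2)] that k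
      by (rule adjacent_shift)
    then show False by presburger
  qed
  have tri: "r (h u) < r (h t)" if "t < k" "u < k" "h t \<noteq> h u" "(h t, g (h u)) \<in> cycle_arcs m" for t u
  proof -
    have "g (h u) = h t + 1 \<or> h t = g (h u) + 1 \<or> h t = 0 \<and> g (h u) + 1 = m \<or> h t + 1 = m \<and> g (h u) = 0"
      using that(4) by (simp add: cycle_arcs_iff[OF m])
    moreover have "t \<noteq> u" using that by auto
    ultimately have "u < t"
      using h(1,2)[OF that(1)] h(1,2)[OF that(2)] g(2,3)[OF h(1)[OF that(2)]] that(1,2) k
      by (rule successor_shift)
    then show ?thesis using h(3) that by simp
  qed
  have "triangular_matching (cycle_arcs m) (h ` {..<k}) (g ` h ` {..<k})"
    unfolding triangular_matching_def
    by (intro exI[of _ g] exI[of _ r]) (use g h indep tri in auto)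
  moreover have "card (h ` {..<k}) = k" using inj by (simp add: card_image)
  moreover have "y < m \<and> (\<exists>t<k. y = \<sigma> + 2 * t + 1 \<or> y + m = \<sigma> + 2 * t + 1)" if "y \<in> g ` h ` {..<k}" for y
  proof -
    obtain t where t: "t < k" "y = g (h t)" using \<open>y \<in> _\<close> by auto
    then have "y = \<sigma> + 2 * t + 1 \<or> y + m = \<sigma> + 2 * t + 1"
      using h(1,2)[OF t(1)] g(2,3)[OF h(1)[OF t(1)]] \<sigma> k by linarith
    moreover have "y < m" using t(2) g(2)[OF h(1)[OF t(1)]] by simp
    ultimately show ?thesis using t(1) by blast
  qed
  moreover have "\<exists>t<k. x = \<sigma> + 2 * t \<or> x + m = \<sigma> + 2 * t" if "x \<in> h ` {..<k}" for x
    using that h(2) by (metis image_iff lessThan_iff)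
  moreover have "h ` {..<k} \<subseteq> {..<m}" using h(1) by auto
  ultimately show ?thesis by blast
qed

text \<open>Here \<open>s\<close> is the deleted vertex and 0 the attaching vertex, which may occur
  in \<open>Y\<close> but not in \<open>X\<close>. For odd \<open>m\<close> all \<open>m - 1\<close>
  remaining vertices are used, so only the direction can be adjusted; for even \<open>m\<close> one
  vertex is left over, so the start can be adjusted.\<close>

lemma cycle_triangular_matching:
  assumes m: "3 \<le> m" and s: "s < m"
  shows "\<exists>X Y. triangular_matching (cycle_arcs m) X Y \<and> X \<subseteq> {1..<m} \<and> Y \<subseteq> {..<m} \<and>
    s \<notin> X \<and> s \<notin> Y \<and> card X = (m - 1) div 2"
proof -
  \<comment> \<open>\<open>odd (m + \<sigma>)\<close> puts the vertex 0, read as \<open>m\<close>,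
    at odd distance from the start \<open>\<sigma>\<close>, where only right-hand sides lie. For
    \<open>s = 0\<close> the path avoids 0 anyway.\<close>
  have fwd: "\<exists>X Y. triangular_matching (cycle_arcs m) X Y \<and> X \<subseteq> {1..<m} \<and> Y \<subseteq> {..<m} \<and>
    s \<notin> X \<and> s \<notin> Y \<and> card X = (m - 1) div 2"
    if \<sigma>: "\<sigma> = s + 1 \<or> even m \<and> \<sigma> = s + 2" "s = 0 \<and> \<sigma> = 1 \<or> odd (m + \<sigma>)" and s: "s < m" for \<sigma> s
  proof -
    have "1 \<le> \<sigma>" "\<sigma> \<le> m + 1" "2 * ((m - 1) div 2) < m" using \<sigma> s m by auto
    from cycle_triangular_matching_forward[OF m this] obtain X Y where XY:
      "triangular_matching (cycle_arcs m) X Y" "X \<subseteq> {..<m}" "card X = (m - 1) div 2"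
      "\<forall>x\<in>X. \<exists>t<(m - 1) div 2. x = \<sigma> + 2 * t \<or> x + m = \<sigma> + 2 * t"
      "\<forall>y\<in>Y. y < m \<and> (\<exists>t<(m - 1) div 2. y = \<sigma> + 2 * t + 1 \<or> y + m = \<sigma> + 2 * t + 1)" by metis
    \<comment> \<open>The extra slack for even \<open>m\<close> is what keeps the path away from
      \<open>s\<close> when it starts at \<open>s + 2\<close>.\<close>
    have bound: "2 * t + 3 \<le> m" "even m \<Longrightarrow> 2 * t + 4 \<le> m" if "t < (m - 1) div 2" for t
      using that m by presburger+
    have X0: "x \<noteq> 0 \<and> x \<noteq> s" if x: "x \<in> X" for x
    proof -
      obtain t where t: "t < (m - 1) div 2" "x = \<sigma> + 2 * t \<or> x + m = \<sigma> + 2 * t" using XY(4) x by blast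
      have "m \<noteq> \<sigma> + 2 * t" using \<sigma>(2) bound(1)[OF t(1)] by auto
      then have "x \<noteq> 0" using t(2) \<open>1 \<le> \<sigma>\<close> by auto
      moreover have "x \<noteq> s" using t(2) \<sigma>(1) bound(1)[OF t(1)] by auto
      ultimately show ?thesis ..
    qed
    have Ym: "y < m \<and> y \<noteq> s" if y: "y \<in> Y" for y
    proof -
      obtain t where t: "t < (m - 1) div 2" "y = \<sigma> + 2 * t + 1 \<or> y + m = \<sigma> + 2 * t + 1"
        using XY(5) y by blast
      have "y \<noteq> s" using t(2) \<sigma>(1) bound[OF t(1)] by auto
      then show ?thesis using XY(5) y by blast
    qed
    have "X \<subseteq> {1..<m}"
    proof
      fix x assume "x \<in> X"
      then show "x \<in> {1..<m}" using X0[of x] XY(2) by auto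
    qed
    moreover have "Y \<subseteq> {..<m}" "s \<notin> X" "s \<notin> Y" using X0 Ym by auto
    ultimately show ?thesis using XY(1,3) by blast
  qed
  consider "s = 0" | "even m" "odd s" | "even m" "even s" | "odd m" "odd s" | "odd m" "even s" "0 < s" by auto
  then show ?thesis
  proof cases
    \<comment> \<open>Neither direction-preserving start has the right parity here, but
      \<open>m - s\<close> is odd: match with \<open>m - s\<close> deleted, then reverse the cycle,
      keeping 0 fixed.\<close>
    case 5
    obtain X Y where XY: "triangular_matching (cycle_arcs m) X Y" "X \<subseteq> {1..<m}" "Y \<subseteq> {..<m}"
      "m - s \<notin> X" "m - s \<notin> Y" "card X = (m - 1) div 2"
      using fwd[of "m - s + 1" "m - s"] 5 s by auto
    define f where "f i = (if i = 0 then 0 else m - i)" for i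
    have inj: "inj_on f {..<m}" by (auto simp: inj_on_def f_def)
    have "triangular_matching (cycle_arcs m) (f ` X) (f ` Y)"
    proof (rule triangular_matching_image[OF XY(1) inj])
      show "X \<union> Y \<subseteq> {..<m}" using XY(2,3) by auto
      fix a b assume "a \<in> {..<m}" "b \<in> {..<m}"
      then show "(f a, f b) \<in> cycle_arcs m \<longleftrightarrow> (a, b) \<in> cycle_arcs m"
        unfolding cycle_arcs_iff[OF m] f_def by auto
    qed
    moreover have "f ` X \<subseteq> {1..<m}" "f ` Y \<subseteq> {..<m}" using XY(2,3) m by (auto simp: f_def)
    moreover have "s \<notin> f ` X" "s \<notin> f ` Y" using XY(2-5) 5 s by (auto simp: f_def subset_iff split: if_splits)
    moreover have "inj_on f X" by (rule inj_on_subset[OF inj]) (use XY(2) in auto)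
    then have "card (f ` X) = (m - 1) div 2" using XY(6) by (simp add: card_image)
    ultimately show ?thesis by blast
  qed (use fwd[of "s + 1" s] fwd[of "s + 2" s] s in auto)
qed

section \<open>Adjacency and matchings in two cycles joined by a path\<close>

lemma glue_eq_iff:
  "glue l (CP i) = glue l (CP j) \<longleftrightarrow> i = j"
  "glue l (CQ i) = glue l (CQ j) \<longleftrightarrow> i = j"
  "glue l (CP i) = PL a \<longleftrightarrow> i = 0 \<and> a = 1"
  "glue l (CQ i) = PL a \<longleftrightarrow> i = 0 \<and> a = l"
  "glue l (CP i) = glue l (CQ j) \<longleftrightarrow> i = 0 \<and> j = 0 \<and> l = 1"
  "glue l (CQ j) = glue l (CP i) \<longleftrightarrow> i = 0 \<and> j = 0 \<and> l = 1"
  by auto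

lemma infty_arcs_iff:
  "(x, y) \<in> parcs (infty_graph p l q) \<longleftrightarrow>
    (\<exists>i j. (i, j) \<in> cycle_arcs p \<and> x = glue l (CP i) \<and> y = glue l (CP j)) \<or>
    (\<exists>i j. (i, j) \<in> path_arcs l \<and> x = PL i \<and> y = PL j) \<or>
    (\<exists>i j. (i, j) \<in> cycle_arcs q \<and> x = glue l (CQ i) \<and> y = glue l (CQ j))"
proof -
  have image: "(x, y) \<in> map_prod (glue l) (glue l) ` map_prod f f ` R \<longleftrightarrow>
      (\<exists>i j. (i, j) \<in> R \<and> x = glue l (f i) \<and> y = glue l (f j))" for R and f :: "nat \<Rightarrow> infty_vertex"
    by (force simp: image_iff simp del: glue.simps)
  show ?thesis unfolding infty_graph_def pair_pre_digraph.simps image_Un Un_iff image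
    by (simp only: glue.simps(2) disj_assoc)
qed

text \<open>The cycle is induced: the path and the other cycle each meet it in at most the attaching
  vertex, so an extra arc would have to be a loop.\<close>

lemma infty_arcs_CP:
  assumes "3 \<le> p" "3 \<le> q"
  shows "(glue l (CP i), glue l (CP j)) \<in> parcs (infty_graph p l q) \<longleftrightarrow> (i, j) \<in> cycle_arcs p"
proof -
  have "(0, 0) \<notin> cycle_arcs q" "(1, 1) \<notin> path_arcs l" using assms by (auto simp: cycle_arcs_iff path_arcs_def)
  then show ?thesis unfolding infty_arcs_iff glue_eq_iff by auto
qed

lemma infty_arcs_CQ:
  assumes "3 \<le> p" "3 \<le> q"
  shows "(glue l (CQ i), glue l (CQ j)) \<in> parcs (infty_graph p l q) \<longleftrightarrow> (i, j) \<in> cycle_arcs q"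
proof -
  have "(0, 0) \<notin> cycle_arcs p" "(l, l) \<notin> path_arcs l" using assms by (auto simp: cycle_arcs_iff path_arcs_def)
  then show ?thesis unfolding infty_arcs_iff glue_eq_iff by auto
qed

text \<open>Without \<open>glue\<close>, the names \<open>CP 0\<close> and \<open>CQ 0\<close>
  denote no vertices, so this concerns exactly the vertices away from the attaching points.\<close>

lemma infty_arcs_cross:
  "(CP i, CQ j) \<notin> parcs (infty_graph p l q)" "(CQ j, CP i) \<notin> parcs (infty_graph p l q)"
  unfolding infty_arcs_iff by (auto split: if_splits)

lemma infty_verts:
  "pverts (infty_graph p l q) = (glue l \<circ> CP) ` {..<p} \<union> PL ` {1..l} \<union> (glue l \<circ> CQ) ` {..<q}"
  by (auto simp: infty_graph_def image_Un image_image image_comp[symmetric] simp del: glue.simps(1,3))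

lemma infty_triangular_matching:
  assumes pq: "3 \<le> p" "3 \<le> q" and x: "x \<in> pverts (infty_graph p l q)"
  shows "\<exists>X Y. triangular_matching (parcs (infty_graph p l q)) X Y \<and>
    X \<union> Y \<subseteq> pverts (infty_graph p l q) \<and> x \<notin> X \<and> x \<notin> Y \<and>
    card X = (p - 1) div 2 + (q - 1) div 2"
proof -
  let ?E = "parcs (infty_graph p l q)"
  \<comment> \<open>The default 0 deletes the attaching vertex of a cycle in which \<open>x\<close>
    is not an unglued vertex.\<close>
  define s where "s = (case x of CP i \<Rightarrow> i | _ \<Rightarrow> 0)"
  define t where "t = (case x of CQ i \<Rightarrow> i | _ \<Rightarrow> 0)"
  have "s < p" "t < q" using x pq by (auto simp: s_def t_def infty_verts split: infty_vertex.splits if_splits)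
  from cycle_triangular_matching[OF pq(1) this(1)] cycle_triangular_matching[OF pq(2) this(2)]
  obtain X Y X' Y' where P: "triangular_matching (cycle_arcs p) X Y" "X \<subseteq> {1..<p}" "Y \<subseteq> {..<p}"
      "s \<notin> X" "s \<notin> Y" "card X = (p - 1) div 2"
    and Q: "triangular_matching (cycle_arcs q) X' Y'" "X' \<subseteq> {1..<q}" "Y' \<subseteq> {..<q}"
      "t \<notin> X'" "t \<notin> Y'" "card X' = (q - 1) div 2" by metis
  define fP where "fP i = glue l (CP i)" for i
  define fQ where "fQ i = glue l (CQ i)" for i
  have inj: "inj_on fP A" "inj_on fQ A" for A by (auto simp: inj_on_def fP_def fQ_def split: if_splits)
  have tP: "triangular_matching ?E (fP ` X) (fP ` Y)"
    using P pq by (intro triangular_matching_image[OF P(1) inj(1), of "{..<p}"])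
      (auto simp: fP_def infty_arcs_CP simp del: glue.simps)
  have tQ: "triangular_matching ?E (fQ ` X') (fQ ` Y')"
    using Q pq by (intro triangular_matching_image[OF Q(1) inj(2), of "{..<q}"])
      (auto simp: fQ_def infty_arcs_CQ simp del: glue.simps)
  have fX: "fP i = CP i" if "i \<in> X" for i using that P(2) by (auto simp: fP_def)
  have fX': "fQ i = CQ i" if "i \<in> X'" for i using that Q(2) by (auto simp: fQ_def)
  have st: "s = 0 \<or> t = 0" by (auto simp: s_def t_def split: infty_vertex.splits)
  have cross: "(a, b) \<notin> ?E \<and> (b, a) \<notin> ?E" if "a \<in> fP ` X" "b \<in> fQ ` X'" for a b
    using that infty_arcs_cross by (auto simp: fX fX')
  \<comment> \<open>On a cycle where the attaching vertex is deleted, the right-hand sides are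
    unglued and meet nothing on the other cycle. By \<open>st\<close> there is such a cycle, and it
    is taken as the second argument of the union.\<close>
  have tm: "triangular_matching ?E (fP ` X \<union> fQ ` X') (fP ` Y \<union> fQ ` Y')"
  proof (cases "t = 0")
    case True
    have "(a, b) \<notin> ?E" if ab: "a \<in> fP ` X" "b \<in> fQ ` Y'" for a b
    proof -
      obtain i where "b = fQ i" "i \<in> Y'" using ab(2) by blast
      then have "b = CQ i" using Q(5) True by (cases "i = 0") (auto simp: fQ_def)
      then show ?thesis using ab(1) infty_arcs_cross by (auto simp: fX)
    qed
    then show ?thesis by (intro triangular_matching_Un tP tQ cross) auto
  next
    case False
    then have "s = 0" using st by simp
    have "(a, b) \<notin> ?E" if ab: "a \<in> fQ ` X'" "b \<in> fP ` Y" for a b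
    proof -
      obtain i where "b = fP i" "i \<in> Y" using ab(2) by blast
      then have "b = CP i" using P(5) \<open>s = 0\<close> by (cases "i = 0") (auto simp: fP_def)
      then show ?thesis using ab(1) infty_arcs_cross by (auto simp: fX')
    qed
    then have "triangular_matching ?E (fQ ` X' \<union> fP ` X) (fQ ` Y' \<union> fP ` Y)"
      using cross by (intro triangular_matching_Un tP tQ) auto
    then show ?thesis by (simp add: Un_commute)
  qed
  have sub: "fP ` X \<union> fQ ` X' \<union> (fP ` Y \<union> fQ ` Y') \<subseteq> pverts (infty_graph p l q)"
    unfolding infty_verts fP_def fQ_def comp_def using P(2,3) Q(2,3)
    by (intro Un_least) (auto simp del: glue.simps)
  have nX: "x \<notin> fP ` X \<union> fQ ` X'"
    using P(4) Q(4) by (auto simp: fX fX' s_def t_def)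
  have nY: "x \<notin> fP ` Y \<union> fQ ` Y'"
    using P(5) Q(5) by (auto simp: fP_def fQ_def s_def t_def split: if_splits)
  have "fP ` X \<inter> fQ ` X' = {}" by (auto simp: fX fX')
  moreover have "finite X" "finite X'" using P(2) Q(2) finite_subset by blast+
  ultimately have "card (fP ` X \<union> fQ ` X') = (p - 1) div 2 + (q - 1) div 2"
    using P(6) Q(6) inj by (simp add: card_Un_disjoint card_image)
  with tm sub nX nY show ?thesis by blast
qed

section \<open>The lower bound and its sharpness\<close>

text \<open>An isomorphism of digraphs carries a separate map on arcs. With \<open>fst\<close> and
  \<open>snd\<close> as tail and head on both sides, that map is forced to be
  \<open>map_prod f f\<close>.\<close>

lemma digraph_iso_with_projD:
  assumes "digraph_iso (with_proj H) (with_proj K)"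
  obtains f where "bij_betw f (pverts H) (pverts K)"
    "\<And>a b. a \<in> pverts H \<Longrightarrow> b \<in> pverts H \<Longrightarrow> (f a, f b) \<in> parcs K \<longleftrightarrow> (a, b) \<in> parcs H"
proof -
  obtain hom where hom: "pre_digraph.digraph_isomorphism (with_proj H) hom"
    and K: "with_proj K = app_iso hom (with_proj H)"
    using assms by (auto simp: digraph_iso_def)
  define f where "f = iso_verts hom"
  have V: "pverts K = f ` pverts H" using arg_cong[OF K, of verts] by (simp add: f_def)
  have A: "parcs K = iso_arcs hom ` parcs H" using arg_cong[OF K, of arcs] by simp
  have th: "fst = iso_tail hom" "snd = iso_head hom"
    using arg_cong[OF K, of tail] arg_cong[OF K, of head] by simp_all
  have wf: "wf_digraph (with_proj H)" and inj: "inj_on f (pverts H)"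
    and ends: "\<forall>e\<in>parcs H. f (fst e) = iso_tail hom (iso_arcs hom e) \<and> f (snd e) = iso_head hom (iso_arcs hom e)"
    using hom by (auto simp: pre_digraph.digraph_isomorphism_def f_def)
  have "iso_arcs hom e = map_prod f f e" if "e \<in> parcs H" for e
    using ends that by (metis fst_map_prod prod_eqI snd_map_prod th)
  then have A': "parcs K = map_prod f f ` parcs H" unfolding A by (intro image_cong) auto
  have wfH: "a \<in> pverts H" "b \<in> pverts H" if "(a, b) \<in> parcs H" for a b
    using wf_digraph.tail_in_verts[OF wf, of "(a, b)"] wf_digraph.head_in_verts[OF wf, of "(a, b)"] that by auto
  have "(f a, f b) \<in> parcs K \<longleftrightarrow> (a, b) \<in> parcs H" if "a \<in> pverts H" "b \<in> pverts H" for a b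
  proof
    assume "(f a, f b) \<in> parcs K"
    then obtain c d where "(c, d) \<in> parcs H" "f a = f c" "f b = f d" unfolding A' by auto
    then show "(a, b) \<in> parcs H" using inj wfH that by (metis inj_onD)
  qed (auto simp: A')
  moreover have "bij_betw f (pverts H) (pverts K)" using inj V by (simp add: bij_betw_def)
  ultimately show ?thesis using that by blast
qed

lemma digraph_iso_with_projI:
  assumes "wf_digraph (with_proj H)" "bij_betw f (pverts H) (pverts K)"
    "parcs K = map_prod f f ` parcs H"
  shows "digraph_iso (with_proj H) (with_proj K)"
proof -
  have "map_prod f f ` parcs H = parcs K" using assms(3) by simp
  have inj: "inj_on (map_prod f f) (parcs H)"
  proof (rule inj_onI)
    fix e e' assume e: "e \<in> parcs H" "e' \<in> parcs H" "map_prod f f e = map_prod f f e'"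
    have "fst e \<in> pverts H" "snd e \<in> pverts H" "fst e' \<in> pverts H" "snd e' \<in> pverts H"
      using wf_digraph.tail_in_verts[OF assms(1)] wf_digraph.head_in_verts[OF assms(1)] e by auto
    then show "e = e'" using e(3) assms(2)
      by (auto simp: bij_betw_def map_prod_def case_prod_beta intro: prod_eqI dest: inj_onD)
  qed
  show ?thesis unfolding digraph_iso_def
    by (rule exI[of _ "\<lparr>iso_verts = f, iso_arcs = map_prod f f, iso_head = snd, iso_tail = fst\<rparr>"])
      (use assms inj in \<open>auto simp: pre_digraph.digraph_isomorphism_def app_iso_def with_proj_def bij_betw_def\<close>)
qed

lemma positive_inertia_ge_infty_base:
  assumes pq: "3 \<le> p" "3 \<le> q" and G: "weighted_graph G w" "bicyclic G" and v: "bij_betw v {..<n} (pverts G)"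
    and z: "pendant_vertex G z" and base: "has_infty_base p l q G"
  shows "1 + (p - 1) div 2 + (q - 1) div 2 \<le> positive_inertia (adjacency_matrix n v G w)"
proof -
  let ?K = "infty_graph p l q"
  interpret pair_graph G using G by (simp add: bicyclic_def)
  obtain H where H: "base_of H G" "digraph_iso (with_proj H) (with_proj ?K)"
    using base by (auto simp: has_infty_base_def)
  obtain f where f: "bij_betw f (pverts H) (pverts ?K)"
    "\<And>a b. a \<in> pverts H \<Longrightarrow> b \<in> pverts H \<Longrightarrow> (f a, f b) \<in> parcs ?K \<longleftrightarrow> (a, b) \<in> parcs H"
    using digraph_iso_with_projD[OF H(2)] by metis
  define g where "g = the_inv_into (pverts H) f"
  have g: "bij_betw g (pverts ?K) (pverts H)" "\<And>a. a \<in> pverts ?K \<Longrightarrow> f (g a) = a"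
    using f(1) by (auto simp: g_def bij_betw_the_inv_into f_the_inv_into_f_bij_betw)
  have gV: "g a \<in> pverts H" if "a \<in> pverts ?K" for a using g(1) that by (auto simp: bij_betw_def)
  have sub: "parcs H \<subseteq> parcs G" using H by (auto simp: base_of_def subgraph_def)
  have gE: "(g a, g b) \<in> parcs G \<longleftrightarrow> (a, b) \<in> parcs ?K" if "a \<in> pverts ?K" "b \<in> pverts ?K" for a b
    using f(2)[of "g a" "g b"] g(2) gV that base_induced[OF G(2) H(1)] sub by auto
  obtain y s where ys: "y \<in> pverts G" "y \<notin> pverts H" "s \<in> pverts H" "(y, s) \<in> parcs G"
    "\<forall>t\<in>pverts H. (y, t) \<in> parcs G \<longrightarrow> t = s"
    using base_attachment[OF G(2) H(1) z] by blast
  have "f s \<in> pverts ?K" using bij_betwE[OF f(1)] ys(3) by blast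
  from infty_triangular_matching[OF pq this] obtain X Y where
    XY: "triangular_matching (parcs ?K) X Y" "X \<union> Y \<subseteq> pverts ?K" "f s \<notin> X" "f s \<notin> Y"
    "card X = (p - 1) div 2 + (q - 1) div 2" by blast
  have inj: "inj_on g (pverts ?K)" using g(1) by (simp add: bij_betw_def)
  have "triangular_matching (parcs G) (g ` X) (g ` Y)"
    by (rule triangular_matching_image[OF XY(1) inj XY(2) gE])
  moreover have nbr: "(y, t) \<notin> parcs G" if t: "t \<in> g ` X \<union> g ` Y" for t
  proof
    assume "(y, t) \<in> parcs G"
    obtain a where a: "a \<in> X \<union> Y" "t = g a" using t by blast
    then have "t = s" using ys(5) gV XY(2) \<open>(y, t) \<in> parcs G\<close> by blast
    then have "a = f s" using g(2) a XY(2) by auto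
    then show False using XY(3,4) a by auto
  qed
  moreover have "triangular_matching (parcs G) {y} {s}"
    using ys(4) no_loops' by (intro triangular_matching_singleton) auto
  \<comment> \<open>The singleton comes first: left-hand sides in the base may be adjacent to
    \<open>s\<close>, whereas \<open>y\<close> is adjacent to none of their partners.\<close>
  ultimately have "triangular_matching (parcs G) ({y} \<union> g ` X) ({s} \<union> g ` Y)"
    using arcs_symmetric by (intro triangular_matching_Un) auto
  from positive_inertia_ge_triangular_matching[OF G(1) v this]
  have "card ({y} \<union> g ` X) \<le> positive_inertia (adjacency_matrix n v G w)" .
  moreover have "y \<notin> g ` X" using gV XY(2) ys(2) by blast
  moreover have "finite X" using XY(1) by (auto simp: triangular_matching_def)
  moreover have "card (g ` X) = card X" using XY(2) by (intro card_image inj_on_subset[OF inj]) auto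
  ultimately show ?thesis using XY(5) by simp
qed

lemma inertia_bound_eq:
  assumes "1 \<le> p" "1 \<le> q"
  shows "inertia_bound p q = real (1 + (p - 1) div 2 + (q - 1) div 2)"
proof -
  have "\<exists>a. m = 2 * a + 1 \<or> m = 2 * a + 2" if "1 \<le> m" for m :: nat using that by presburger
  from this[OF assms(1)] this[OF assms(2)]
  obtain a b where a: "p = 2 * a + 1 \<or> p = 2 * a + 2" and b: "q = 2 * b + 1 \<or> q = 2 * b + 2" by blast
  show ?thesis using a b by (auto simp: inertia_bound_def field_simps)
qed

section \<open>The extremal example\<close>

text \<open>
  The sharp example on \<open>0, \<dots>, p + q - 1\<close>: the first cycle is \<open>0, \<dots>, p - 1\<close>, the second one
  \<open>0, p, \<dots>, p + q - 2\<close>, and \<open>p + q - 1\<close> is the pendant vertex.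
\<close>

definition glue_offset :: "nat \<Rightarrow> nat \<Rightarrow> nat" where
  "glue_offset p j = (if j = 0 then 0 else p + j - 1)"

definition sharp_base :: "nat \<Rightarrow> nat \<Rightarrow> nat pair_pre_digraph" where
  "sharp_base p q = \<lparr> pverts = {..<p + q - 1},
     parcs = cycle_arcs p \<union> map_prod (glue_offset p) (glue_offset p) ` cycle_arcs q \<rparr>"

definition sharp_graph :: "nat \<Rightarrow> nat \<Rightarrow> nat pair_pre_digraph" where
  "sharp_graph p q = \<lparr> pverts = {..<p + q},
     parcs = parcs (sharp_base p q) \<union> {(0, p + q - 1), (p + q - 1, 0)} \<rparr>"

text \<open>Stepping repeatedly to a smaller neighbour leads from every vertex to 0, and symmetry of
  the arcs leads back.\<close>

lemma connected_if_parents: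
  fixes G :: "nat pair_pre_digraph"
  assumes "pair_graph G" and V: "pverts G = {..<n}" "0 < n"
    and parent: "\<And>a. 0 < a \<Longrightarrow> a < n \<Longrightarrow> \<exists>b<a. (a, b) \<in> parcs G"
  shows "Digraph_Component.connected (with_proj G)"
proof -
  interpret pair_graph G by fact
  have to0: "a \<rightarrow>\<^sup>*\<^bsub>with_proj G\<^esub> 0" if "a < n" for a
    using that
  proof (induction a rule: less_induct)
    case (less a)
    show ?case
    proof (cases "a = 0")
      case False
      then obtain b where b: "b < a" "(a, b) \<in> parcs G" using parent less.prems by blast
      then have "b \<rightarrow>\<^sup>*\<^bsub>with_proj G\<^esub> 0" using less by simp
      then show ?thesis using b(2) adj_reachable_trans[of a b 0] by simp
    qed (use V in simp)
  qed
  then have "0 \<rightarrow>\<^sup>*\<^bsub>with_proj G\<^esub> a" if "a < n" for a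
    using symmetric_reachable[OF pair_sym_arcs] that by blast
  then have "a \<rightarrow>\<^sup>*\<^bsub>with_proj G\<^esub> b" if "a < n" "b < n" for a b
    using to0 that reachable_trans by blast
  then have "strongly_connected (with_proj G)" using V by (auto simp: strongly_connected_def)
  moreover have "pverts (mk_symmetric (with_proj G)) = pverts G" by (simp add: mk_symmetric_def)
  ultimately show ?thesis
    by (simp add: Digraph_Component.connected_def strongly_connected_def
        reachable_mk_symmetric_eq[OF pair_sym_arcs])
qed

text \<open>Each edge joins a vertex to its successor, and for \<open>3 \<le> m\<close> in only one
  way; for two vertices both successor pairs would coincide.\<close>

lemma card_cycle_edges:
  assumes m: "3 \<le> m"
  shows "card ((\<lambda>(u, v). {u, v}) ` cycle_arcs m) = m"
proof -
  define s where "s i = (if i + 1 = m then 0 else i + 1)" for i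
  have "(\<lambda>(u, v). {u, v}) ` cycle_arcs m = (\<lambda>i. {i, s i}) ` {..<m}"
  proof (intro equalityI subsetI)
    fix e assume "e \<in> (\<lambda>(u, v). {u, v}) ` cycle_arcs m"
    then obtain i j where ij: "(i, j) \<in> cycle_arcs m" "e = {i, j}" by auto
    then have "i < m" "j < m" "j = s i \<or> i = s j" by (auto simp: cycle_arcs_iff[OF m] s_def)
    then show "e \<in> (\<lambda>i. {i, s i}) ` {..<m}" using ij(2) by auto
  next
    fix e assume "e \<in> (\<lambda>i. {i, s i}) ` {..<m}"
    then obtain i where "i < m" "e = {i, s i}" by auto
    moreover from this have "(i, s i) \<in> cycle_arcs m" using m by (auto simp: cycle_arcs_iff[OF m] s_def)
    ultimately show "e \<in> (\<lambda>(u, v). {u, v}) ` cycle_arcs m" by force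
  qed
  moreover have "inj_on (\<lambda>i. {i, s i}) {..<m}"
    using m by (auto simp: inj_on_def doubleton_eq_iff s_def split: if_splits)
  ultimately show ?thesis by (simp add: card_image)
qed

lemma inj_glue_offset: "3 \<le> p \<Longrightarrow> inj (glue_offset p)"
  by (auto simp: inj_on_def glue_offset_def split: if_splits)

lemma sharp_base_arcs_bounds:
  assumes "3 \<le> p" "3 \<le> q" "(a, b) \<in> parcs (sharp_base p q)"
  shows "a < p + q - 1" "b < p + q - 1" "a \<noteq> b" "(b, a) \<in> parcs (sharp_base p q)"
proof -
  have sym: "(j, i) \<in> cycle_arcs m" if "(i, j) \<in> cycle_arcs m" for i j m
    using that by (auto simp: cycle_arcs_def)
  show "(b, a) \<in> parcs (sharp_base p q)" using assms(3) sym by (force simp: sharp_base_def)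
  show "a < p + q - 1" "b < p + q - 1" "a \<noteq> b" using assms
    by (auto simp: sharp_base_def cycle_arcs_iff glue_offset_def split: if_splits)
qed

lemma pair_graph_if_irreflexive_symmetric:
  assumes "finite (pverts G)"
    and arcs: "\<And>a b. (a, b) \<in> parcs G \<Longrightarrow> a \<in> pverts G \<and> b \<in> pverts G \<and> a \<noteq> b \<and> (b, a) \<in> parcs G"
  shows "pair_graph G"
proof -
  have "parcs G \<subseteq> pverts G \<times> pverts G" using arcs by auto
  then have "finite (parcs G)" using assms(1) by (meson finite_SigmaI finite_subset)
  then show ?thesis
    by unfold_locales (use assms in \<open>auto simp: symmetric_def intro!: symI\<close>)
qed

lemma pair_graph_sharp_base:
  assumes "3 \<le> p" "3 \<le> q" shows "pair_graph (sharp_base p q)"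
proof (rule pair_graph_if_irreflexive_symmetric)
  fix a b assume "(a, b) \<in> parcs (sharp_base p q)"
  from sharp_base_arcs_bounds[OF assms this]
  show "a \<in> pverts (sharp_base p q) \<and> b \<in> pverts (sharp_base p q) \<and> a \<noteq> b \<and> (b, a) \<in> parcs (sharp_base p q)"
    by (simp add: sharp_base_def)
qed (simp add: sharp_base_def)

lemma pair_graph_sharp_graph:
  assumes "3 \<le> p" "3 \<le> q" shows "pair_graph (sharp_graph p q)"
proof (rule pair_graph_if_irreflexive_symmetric)
  fix a b assume "(a, b) \<in> parcs (sharp_graph p q)"
  then consider "(a, b) \<in> parcs (sharp_base p q)" | "a = 0" "b = p + q - 1" | "a = p + q - 1" "b = 0"
    by (auto simp: sharp_graph_def)
  then show "a \<in> pverts (sharp_graph p q) \<and> b \<in> pverts (sharp_graph p q) \<and> a \<noteq> b \<and> (b, a) \<in> parcs (sharp_graph p q)"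
  proof cases
    case 1
    from sharp_base_arcs_bounds[OF assms this] show ?thesis by (auto simp: sharp_graph_def)
  qed (use assms in \<open>auto simp: sharp_graph_def\<close>)
qed (simp add: sharp_graph_def)

lemma sharp_base_parent:
  assumes "3 \<le> p" "3 \<le> q" "0 < a" "a < p + q - 1"
  shows "\<exists>b<a. (a, b) \<in> parcs (sharp_base p q)"
proof (cases "a < p")
  case True
  then have "(a, a - 1) \<in> cycle_arcs p" using assms by (auto simp: cycle_arcs_iff)
  then show ?thesis using assms(3) by (intro exI[of _ "a - 1"]) (simp add: sharp_base_def)
next
  case False
  \<comment> \<open>As a vertex of the second cycle, \<open>a\<close> has position
    \<open>a - p + 1\<close>; for \<open>a = p\<close> its predecessor is the common vertex
    0.\<close>
  then have "(a - p + 1, a - p) \<in> cycle_arcs q" using assms by (auto simp: cycle_arcs_iff)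
  moreover have "glue_offset p (a - p + 1) = a" using False by (simp add: glue_offset_def)
  moreover have "glue_offset p (a - p) < a" using False assms by (auto simp: glue_offset_def)
  ultimately show ?thesis unfolding sharp_base_def by (intro exI[of _ "glue_offset p (a - p)"]) force
qed

lemma card_uedges_sharp_base:
  assumes "3 \<le> p" "3 \<le> q"
  shows "card (uedges (sharp_base p q)) = p + q"
proof -
  define U :: "nat rel \<Rightarrow> nat set set" where "U R = (\<lambda>(u, v). {u, v}) ` R" for R
  have "uedges (sharp_base p q) = U (cycle_arcs p) \<union> image (glue_offset p) ` U (cycle_arcs q)"
    by (auto simp: uedges_def sharp_base_def U_def image_Un image_image case_prod_beta)
  moreover have "U (cycle_arcs p) \<inter> image (glue_offset p) ` U (cycle_arcs q) = {}"
  proof (rule ccontr)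
    assume "\<not> ?thesis"
    then obtain i j k m where ij: "(i, j) \<in> cycle_arcs p" and km: "(k, m) \<in> cycle_arcs q"
      and eq: "{i, j} = {glue_offset p k, glue_offset p m}" by (auto simp: U_def)
    have "glue_offset p k < p" "glue_offset p m < p" using eq ij assms by (auto simp: doubleton_eq_iff cycle_arcs_iff)
    then have "k = 0" "m = 0" by (auto simp: glue_offset_def split: if_splits)
    then show False using km assms by (simp add: cycle_arcs_iff)
  qed
  moreover have "finite (cycle_arcs p)" for p
    by (rule finite_subset[of _ "{..<p} \<times> {..<p}"]) (auto simp: cycle_arcs_def)
  then have "finite (U (cycle_arcs p))" for p by (simp add: U_def)
  moreover have "card (U (cycle_arcs p)) = p" "card (U (cycle_arcs q)) = q"
    using assms card_cycle_edges by (auto simp: U_def)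
  moreover have "card (image (glue_offset p) ` U (cycle_arcs q)) = card (U (cycle_arcs q))"
    by (rule card_image) (metis inj_image_eq_iff inj_glue_offset[OF assms(1)] inj_onI)
  ultimately show ?thesis by (simp add: card_Un_disjoint)
qed

lemma bicyclic_sharp_base:
  assumes "3 \<le> p" "3 \<le> q" shows "bicyclic (sharp_base p q)"
proof -
  have "Digraph_Component.connected (with_proj (sharp_base p q))"
    using assms sharp_base_parent
    by (intro connected_if_parents[OF pair_graph_sharp_base]) (auto simp: sharp_base_def)
  then show ?thesis using assms pair_graph_sharp_base card_uedges_sharp_base
    by (simp add: bicyclic_def sharp_base_def)
qed

lemma bicyclic_sharp_graph:
  assumes "3 \<le> p" "3 \<le> q" shows "bicyclic (sharp_graph p q)"
proof -
  have "\<exists>b<a. (a, b) \<in> parcs (sharp_graph p q)" if "0 < a" "a < p + q" for a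
  proof (cases "a = p + q - 1")
    case False
    then show ?thesis using that sharp_base_parent[OF assms, of a] by (auto simp: sharp_graph_def)
  qed (use that assms in \<open>auto simp: sharp_graph_def intro!: exI[of _ 0]\<close>)
  then have "Digraph_Component.connected (with_proj (sharp_graph p q))"
    using assms by (intro connected_if_parents[OF pair_graph_sharp_graph]) (auto simp: sharp_graph_def)
  moreover have "uedges (sharp_graph p q) = insert {0, p + q - 1} (uedges (sharp_base p q))"
    by (auto simp: uedges_def sharp_graph_def)
  moreover have "{0, p + q - 1} \<notin> uedges (sharp_base p q)"
    using sharp_base_arcs_bounds(1,2)[OF assms] by (fastforce simp: uedges_def doubleton_eq_iff)
  moreover have "finite (uedges (sharp_base p q))"
    using card_uedges_sharp_base[OF assms] assms by (intro card_ge_0_finite) simp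
  ultimately show ?thesis using card_uedges_sharp_base[OF assms] pair_graph_sharp_graph[OF assms]
    by (simp add: bicyclic_def sharp_graph_def)
qed

lemma no_pendant_sharp_base:
  assumes pq: "3 \<le> p" "3 \<le> q" shows "\<not> pendant_vertex (sharp_base p q) a"
proof
  interpret pair_graph "sharp_base p q" by (rule pair_graph_sharp_base[OF pq])
  assume a: "pendant_vertex (sharp_base p q) a"
  have two: "\<exists>i j. (k, i) \<in> cycle_arcs m \<and> (k, j) \<in> cycle_arcs m \<and> i \<noteq> j" if "k < m" "3 \<le> m" for k m
  proof -
    have "(k, if k + 1 = m then 0 else k + 1) \<in> cycle_arcs m" "(k, if k = 0 then m - 1 else k - 1) \<in> cycle_arcs m"
      "(if k + 1 = m then 0 else k + 1) \<noteq> (if k = 0 then m - 1 else k - 1)"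
      using that by (auto simp: cycle_arcs_iff)
    then show ?thesis by blast
  qed
  have "a < p + q - 1" using a by (simp add: pendant_vertex_def sharp_base_def)
  have "\<exists>b c. (a, b) \<in> parcs (sharp_base p q) \<and> (a, c) \<in> parcs (sharp_base p q) \<and> b \<noteq> c"
  proof (cases "a < p")
    case True
    then show ?thesis using two[OF True pq(1)] by (auto simp: sharp_base_def)
  next
    case False
    have "a - p + 1 < q" using False \<open>a < p + q - 1\<close> by simp
    then obtain i j where ij: "(a - p + 1, i) \<in> cycle_arcs q" "(a - p + 1, j) \<in> cycle_arcs q" "i \<noteq> j"
      using two pq(2) by blast
    have "glue_offset p (a - p + 1) = a" using False by (simp add: glue_offset_def)
    then have "(a, glue_offset p i) \<in> parcs (sharp_base p q)" "(a, glue_offset p j) \<in> parcs (sharp_base p q)"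
      using ij unfolding sharp_base_def by force+
    then show ?thesis using ij(3) inj_glue_offset[OF pq(1)] by (meson injD)
  qed
  then obtain b c where bc: "(a, b) \<in> parcs (sharp_base p q)" "(a, c) \<in> parcs (sharp_base p q)" "b \<noteq> c" by blast
  have "card {(a, b), (a, c)} \<le> card {e \<in> parcs (sharp_base p q). fst e = a}"
    using bc pair_finite_arcs by (intro card_mono) auto
  then show False using a bc(3) by (simp add: pendant_vertex_def out_degree_def out_arcs_def)
qed

lemma pendant_sharp_graph:
  assumes "3 \<le> p" "3 \<le> q" shows "pendant_vertex (sharp_graph p q) (p + q - 1)"
proof -
  have "{e \<in> parcs (sharp_graph p q). fst e = p + q - 1} = {(p + q - 1, 0)}"
    using assms by (auto simp: sharp_graph_def dest: sharp_base_arcs_bounds(1)[OF assms])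
  then show ?thesis using assms by (simp add: pendant_vertex_def out_degree_def out_arcs_def sharp_graph_def)
qed

lemma base_sharp_graph:
  assumes "3 \<le> p" "3 \<le> q" shows "base_of (sharp_base p q) (sharp_graph p q)"
proof -
  interpret H: pair_graph "sharp_base p q" by (rule pair_graph_sharp_base[OF assms])
  interpret G: pair_graph "sharp_graph p q" by (rule pair_graph_sharp_graph[OF assms])
  have "subgraph (with_proj (sharp_base p q)) (with_proj (sharp_graph p q))"
    unfolding subgraph_def using H.wf_digraph_axioms G.wf_digraph_axioms
    by (auto simp: sharp_graph_def) (auto simp: sharp_base_def)
  then show ?thesis using bicyclic_sharp_base no_pendant_sharp_base assms by (simp add: base_of_def)
qed

lemma sharp_base_iso:
  assumes pq: "3 \<le> p" "3 \<le> q"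
  shows "digraph_iso (with_proj (sharp_base p q)) (with_proj (infty_graph p 1 q))"
proof -
  interpret H: pair_graph "sharp_base p q" by (rule pair_graph_sharp_base[OF pq])
  define f where "f a = (if a = 0 then PL 1 else if a < p then CP a else CQ (a - p + 1))" for a
  have f: "f i = glue 1 (CP i)" if "i < p" for i using that by (auto simp: f_def)
  have f': "f (glue_offset p j) = glue 1 (CQ j)" for j using pq by (auto simp: f_def glue_offset_def)
  have V: "{..<p + q - 1} = {..<p} \<union> glue_offset p ` {..<q}"
  proof (intro equalityI subsetI)
    fix a assume "a \<in> {..<p + q - 1}"
    moreover have "a = glue_offset p (a - p + 1)" if "p \<le> a" using that by (simp add: glue_offset_def)
    ultimately show "a \<in> {..<p} \<union> glue_offset p ` {..<q}"
      by (cases "a < p") (auto intro!: image_eqI[of _ _ "a - p + 1"])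
  qed (use pq in \<open>auto simp: glue_offset_def\<close>)
  have "f ` pverts (sharp_base p q) = pverts (infty_graph p 1 q)"
  proof -
    have "PL 1 \<in> (glue 1 \<circ> CP) ` {..<p}" using pq by (force simp: image_iff)
    moreover have "f ` {..<p} = (glue 1 \<circ> CP) ` {..<p}" by (rule image_cong) (auto simp: f)
    moreover have "f ` glue_offset p ` {..<q} = (glue 1 \<circ> CQ) ` {..<q}"
      unfolding image_image by (rule image_cong) (auto simp: f')
    moreover have "pverts (sharp_base p q) = {..<p} \<union> glue_offset p ` {..<q}"
      using V by (simp add: sharp_base_def)
    ultimately show ?thesis unfolding infty_verts by (simp add: image_Un insert_absorb)
  qed
  moreover have "inj_on f (pverts (sharp_base p q))" by (auto simp: inj_on_def f_def split: if_splits)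
  moreover have "parcs (infty_graph p 1 q) = map_prod f f ` parcs (sharp_base p q)"
  proof -
    have "path_arcs 1 = {}" by (auto simp: path_arcs_def)
    then have "parcs (infty_graph p 1 q) =
        map_prod (glue 1 \<circ> CP) (glue 1 \<circ> CP) ` cycle_arcs p \<union> map_prod (glue 1 \<circ> CQ) (glue 1 \<circ> CQ) ` cycle_arcs q"
      by (simp add: infty_graph_def image_Un image_comp map_prod.comp del: glue.simps)
    moreover have "map_prod (glue 1 \<circ> CP) (glue 1 \<circ> CP) ` cycle_arcs p = map_prod f f ` cycle_arcs p"
      by (rule image_cong) (auto simp: f cycle_arcs_def simp del: glue.simps)
    moreover have "map_prod (glue 1 \<circ> CQ) (glue 1 \<circ> CQ) ` cycle_arcs q =
        map_prod f f ` map_prod (glue_offset p) (glue_offset p) ` cycle_arcs q"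
      unfolding image_image by (rule image_cong) (auto simp: f' simp del: glue.simps)
    ultimately show ?thesis by (simp add: sharp_base_def image_Un)
  qed
  ultimately show ?thesis
    by (intro digraph_iso_with_projI[OF H.wf_digraph_axioms]) (auto simp: bij_betw_def)
qed

text \<open>The independent set consists of the pendant vertex and the odd positions of both cycles.
  It avoids 0, the only neighbour of the pendant vertex, and has
  \<open>1 + p div 2 + q div 2\<close> elements.\<close>

lemma positive_inertia_sharp_graph_le:
  assumes pq: "3 \<le> p" "3 \<le> q"
  shows "positive_inertia (adjacency_matrix (p + q) id (sharp_graph p q) w) \<le> 1 + (p - 1) div 2 + (q - 1) div 2"
proof -
  define P where "P = (\<lambda>t. 2 * t + 1) ` {..<p div 2}"
  \<comment> \<open>\<open>p + 2 * t\<close> is position \<open>2 * t + 1\<close> of the second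
    cycle.\<close>
  define Q where "Q = (\<lambda>t. p + 2 * t) ` {..<q div 2}"
  define I where "I = insert (p + q - 1) (P \<union> Q)"
  have P: "odd i \<and> i < p" if "i \<in> P" for i using that by (auto simp: P_def)
  have Q: "\<exists>j. odd j \<and> j < q \<and> i = glue_offset p j" if i: "i \<in> Q" for i
  proof -
    obtain t where "t < q div 2" "i = p + 2 * t" using i by (auto simp: Q_def)
    then show ?thesis by (intro exI[of _ "2 * t + 1"]) (auto simp: glue_offset_def)
  qed
  have Qb: "p \<le> i \<and> i < p + q - 1" if "i \<in> Q" for i
    using that pq by (auto simp: Q_def)
  \<comment> \<open>Neighbours on a cycle differ in parity, except possibly across the closing edge,
    and that one contains the even position 0.\<close>
  have indep: "(i, j) \<notin> cycle_arcs m" if "3 \<le> m" "odd i" "odd j" for i j m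
    using that by (auto simp: cycle_arcs_iff intro: odd_pos)
  have "positive_inertia (adjacency_matrix (p + q) id (sharp_graph p q) w) + card I \<le> p + q"
  proof (rule positive_inertia_le_independent[OF pair_graph_sharp_graph[OF pq]])
    show "bij_betw id {..<p + q} (pverts (sharp_graph p q))" by (simp add: sharp_graph_def)
    show "I \<subseteq> pverts (sharp_graph p q)" using P Qb pq by (fastforce simp: I_def sharp_graph_def)
    have 0: "i \<noteq> 0" if "i \<in> I" for i using that P[of i] Qb[of i] pq by (auto simp: I_def intro: odd_pos)
    fix i j assume ij: "i \<in> I" "j \<in> I"
    show "(i, j) \<notin> parcs (sharp_graph p q)"
    proof
      assume "(i, j) \<in> parcs (sharp_graph p q)"
      then have arc: "(i, j) \<in> parcs (sharp_base p q)" using 0 ij by (auto simp: sharp_graph_def)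
      then have "i \<in> P \<union> Q" "j \<in> P \<union> Q" using ij sharp_base_arcs_bounds(1,2)[OF pq arc] by (auto simp: I_def)
      from arc consider "(i, j) \<in> cycle_arcs p"
        | k l where "(k, l) \<in> cycle_arcs q" "i = glue_offset p k" "j = glue_offset p l"
        by (auto simp: sharp_base_def)
      then show False
      proof cases
        case 1
        then have "i < p" "j < p" by (auto simp: cycle_arcs_def)
        then have "i \<in> P" "j \<in> P" using \<open>i \<in> P \<union> Q\<close> \<open>j \<in> P \<union> Q\<close> Qb by force+
        then show False using P indep[OF pq(1)] 1 by blast
      next
        case 2
        have "i \<noteq> 0" "j \<noteq> 0" using 0 ij by blast+
        then have "k \<noteq> 0" "l \<noteq> 0" using 2(2,3) by (auto simp: glue_offset_def split: if_splits)
        then have "p \<le> i" "p \<le> j" using 2 by (auto simp: glue_offset_def)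
        then have "i \<in> Q" "j \<in> Q" using \<open>i \<in> P \<union> Q\<close> \<open>j \<in> P \<union> Q\<close> P by force+
        then have "odd k" "odd l" using Q 2 inj_glue_offset[OF pq(1)] by (metis injD)+
        then show False using indep[OF pq(2)] 2 by blast
      qed
    qed
  qed
  moreover have "card I = 1 + p div 2 + q div 2"
  proof -
    have "card P = p div 2" "card Q = q div 2"
      unfolding P_def Q_def by (subst card_image; simp add: inj_on_def)+
    moreover have "P \<inter> Q = {}" "p + q - 1 \<notin> P \<union> Q" using P Qb pq by fastforce+
    moreover have "finite P" "finite Q" by (auto simp: P_def Q_def)
    ultimately show ?thesis by (simp add: I_def card_Un_disjoint)
  qed
  moreover have "m div 2 + (m - 1) div 2 = m - 1" if "1 \<le> m" for m :: nat using that by presburger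
  from this[of p] this[of q] have "p div 2 + (p - 1) div 2 = p - 1" "q div 2 + (q - 1) div 2 = q - 1" using pq by auto
  ultimately show ?thesis using pq by linarith
qed

theorem theorem3p1:
  fixes p q :: nat
  assumes "3 \<le> p" and "3 \<le> q"
  shows
    "(\<forall>l n v (G :: 'a pair_pre_digraph) w.
        1 \<le> l \<and> weighted_graph G w \<and> bicyclic G \<and> bij_betw v {..<n} (pverts G) \<and>
        (\<exists>x. pendant_vertex G x) \<and> has_infty_base p l q G \<longrightarrow>
        real (positive_inertia (adjacency_matrix n v G w)) \<ge> inertia_bound p q) \<and>
     (\<exists>l n v (G :: nat pair_pre_digraph) w.
        1 \<le> l \<and> weighted_graph G w \<and> bicyclic G \<and> bij_betw v {..<n} (pverts G) \<and>
        (\<exists>x. pendant_vertex G x) \<and> has_infty_base p l q G \<and>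
        real (positive_inertia (adjacency_matrix n v G w)) = inertia_bound p q)"
proof -
  have bound: "inertia_bound p q = real (1 + (p - 1) div 2 + (q - 1) div 2)"
    using assms by (intro inertia_bound_eq) auto
  show ?thesis
  proof (intro conjI allI impI)
    fix l n :: nat and v :: "nat \<Rightarrow> 'a" and G :: "'a pair_pre_digraph" and w
    assume "1 \<le> l \<and> weighted_graph G w \<and> bicyclic G \<and> bij_betw v {..<n} (pverts G) \<and>
        (\<exists>x. pendant_vertex G x) \<and> has_infty_base p l q G"
    then show "inertia_bound p q \<le> real (positive_inertia (adjacency_matrix n v G w))"
      unfolding bound of_nat_le_iff
      by (elim conjE exE) (rule positive_inertia_ge_infty_base[OF assms])
  next
    let ?G = "sharp_graph p q" and ?w = "\<lambda>_. 1 :: real"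
    have G: "weighted_graph ?G ?w" "bicyclic ?G" "bij_betw id {..<p + q} (pverts ?G)"
      "pendant_vertex ?G (p + q - 1)"
      using assms pair_graph_sharp_graph bicyclic_sharp_graph pendant_sharp_graph
      by (simp_all add: weighted_graph_def) (simp add: sharp_graph_def)
    have base: "has_infty_base p 1 q ?G"
      unfolding has_infty_base_def using base_sharp_graph[OF assms] sharp_base_iso[OF assms] by blast
    \<comment> \<open>The independent set bounds the inertia from above; the matching lower bound is
      the general one, applied to this example.\<close>
    have "real (positive_inertia (adjacency_matrix (p + q) id ?G ?w)) = inertia_bound p q"
      unfolding bound of_nat_eq_iff
      by (rule antisym[OF positive_inertia_sharp_graph_le[OF assms]
            positive_inertia_ge_infty_base[OF assms G base]])
    with G base show "\<exists>l n v (G :: nat pair_pre_digraph) w.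
        1 \<le> l \<and> weighted_graph G w \<and> bicyclic G \<and> bij_betw v {..<n} (pverts G) \<and>
        (\<exists>x. pendant_vertex G x) \<and> has_infty_base p l q G \<and>
        real (positive_inertia (adjacency_matrix n v G w)) = inertia_bound p q" by blast
  qed
qed

end
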